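(* Let $G=SO^*(6)$ and $\Lambda\in\wedge^*_{\mathbb{Q},+}\cap\mathcal{C}_{\mathrm{hol}}$. The Kirwan polyhedron $\Delta_K(\mathcal{O}_\Lambda)$ is the set of $\xi=(\xi_1,\xi_2,\xi_3)\in\mathfrak{t}^*$ defined by the following inequalities: $$\begin{aligned}-\xi_1+\xi_2+\xi_3&\ge-\Lambda_1+\Lambda_2+\Lambda_3,\\ \xi_1-\xi_2+\xi_3&\ge\Lambda_1-\Lambda_2+\Lambda_3,\\ \xi_1+\xi_2-\xi_3&\ge\Lambda_1+\Lambda_2-\Lambda_3,\\ \xi_1-\xi_2-\xi_3&\ge-\Lambda_1+\Lambda_2-\Lambda_3,\\ -\xi_1+\xi_2-\xi_3&\ge-\Lambda_1-\Lambda_2+\Lambda_3,\\ \xi_1\ge\xi_2&\ge\xi_3.\end{aligned}$$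
   Context: For $n\ge3$, $SO^*(2n)=\{M\in SU(n,n):{}^tM\begin{pmatrix}0 & I_n \\ I_n & 0\end{pmatrix}M=\begin{pmatrix}0 & I_n \\ I_n & 0\end{pmatrix}\}$; here $n=3$. $K=\{\mathrm{diag}(U,\overline{U}):U\in U(n)\}\cong U(n)$; $T$ is the torus corresponding to diagonal matrices of $U(n)$, with Lie algebra $\mathfrak{t}$ with basis $e_1,\dots,e_n$, $e_k$ corresponding to the diagonal matrix in $\mathfrak{u}(n)$ with $k$-th entry $i$ and $0$ elsewhere; $\xi\in\mathfrak{t}^*$ is written $(\xi_1,\dots,\xi_n)$ in the dual basis $(e_k^* )$. $\mathfrak{t}_+^*=\{\xi_1\ge\dots\ge\xi_n\}$, $\wedge^*_{\mathbb{Q}}=\mathbb{Q}^n$, $\wedge^*_{\mathbb{Q},+}=\mathbb{Q}^n\cap\mathfrak{t}_+^*$. The positive noncompact roots are $e_i^*+e_j^*$, $1\le i<j\le n$, and $\mathcal{C}_{\mathrm{hol}}$ is the set of $\xi\in\mathfrak{t}_+^*$ having strictly positive inner product (for the Killing form) with all of them, i.e. $\xi_1\ge\dots\ge\xi_n$ and $\xi_{n-1}+\xi_n>0$. $\mathcal{O}_\Lambda=G\cdot\Lambda\subset\mathfrak{g}^*$ is the coadjoint orbit ($\mathfrak{t}^*\subset\mathfrak{k}^*\subset\mathfrak{g}^*$ via the Killing form) and $\Delta_K(\mathcal{O}_\Lambda)$ is the intersection with $\mathfrak{t}_+^*$ of the image of $\mathcal{O}_\Lambda$ under the restriction map $\mathfrak{g}^*\to\mathfrak{k}^*$.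 *)

theory Defs
  imports "HOL-Analysis.Analysis"
begin

text \<open>Matrices of size $2n$ are indexed by the sum type \<^typ>\<open>'n + 'n\<close> with \<open>CARD('n) = n\<close>.\<close>

type_synonym 'n cmat = "complex ^ 'n ^ 'n"

definition block :: "'n::finite cmat \<Rightarrow> 'n cmat \<Rightarrow> 'n cmat \<Rightarrow> 'n cmat \<Rightarrow> ('n + 'n) cmat" where
  "block A B C D = (\<chi> r c. case r of
      Inl i \<Rightarrow> (case c of Inl j \<Rightarrow> A $ i $ j | Inr j \<Rightarrow> B $ i $ j)
    | Inr i \<Rightarrow> (case c of Inl j \<Rightarrow> C $ i $ j | Inr j \<Rightarrow> D $ i $ j))"

definition conj_mat :: "'n::finite cmat \<Rightarrow> 'n cmat" where
  "conj_mat M = map_matrix cnj M"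

definition hermitian_adjoint :: "'n::finite cmat \<Rightarrow> 'n cmat" where
  "hermitian_adjoint M = transpose (conj_mat M)"

definition unitary_group :: "'n::finite cmat set" where
  "unitary_group = {U. hermitian_adjoint U ** U = mat 1}"

definition SU_nn :: "('n::finite + 'n) cmat set" where
  "SU_nn = {M. det M = 1 \<and>
     hermitian_adjoint M ** block (mat 1) 0 0 (- mat 1) ** M = block (mat 1) 0 0 (- mat 1)}"

definition SO_star :: "('n::finite + 'n) cmat set" where
  "SO_star = {M \<in> SU_nn.
     transpose M ** block 0 (mat 1) (mat 1) 0 ** M = block 0 (mat 1) (mat 1) 0}"

definition K_group :: "('n::finite + 'n) cmat set" where
  "K_group = {block U 0 0 (conj_mat U) | U. U \<in> unitary_group}"

definition T_group :: "('n::finite + 'n) cmat set" where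
  "T_group = {block U 0 0 (conj_mat U) | U.
     U \<in> unitary_group \<and> (\<forall>i j. i \<noteq> j \<longrightarrow> U $ i $ j = 0)}"

text \<open>The Lie algebra of a matrix group is its tangent space at the identity.\<close>

definition lie_algebra :: "'m::finite cmat set \<Rightarrow> 'm cmat set" where
  "lie_algebra G = {X. \<exists>\<gamma> :: real \<Rightarrow> 'm cmat.
     (\<forall>s. \<gamma> s \<in> G) \<and> \<gamma> 0 = mat 1 \<and> (\<gamma> has_vector_derivative X) (at 0)}"

abbreviation g_alg :: "('n::finite + 'n) cmat set" where
  "g_alg \<equiv> lie_algebra SO_star"

abbreviation k_alg :: "('n::finite + 'n) cmat set" where
  "k_alg \<equiv> lie_algebra K_group"

abbreviation t_alg :: "('n::finite + 'n) cmat set" where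
  "t_alg \<equiv> lie_algebra T_group"

definition t_basis :: "'n::finite \<Rightarrow> ('n + 'n) cmat" where
  "t_basis k = (let D = (\<chi> i j. if i = k \<and> j = k then \<i> else 0) in block D 0 0 (conj_mat D))"

definition lie_bracket :: "'m::finite cmat \<Rightarrow> 'm cmat \<Rightarrow> 'm cmat" where
  "lie_bracket X Y = X ** Y - Y ** X"

text \<open>Trace of a linear endomorphism of a finite-dimensional real subspace \<open>V\<close>; the value
  does not depend on the chosen basis.\<close>

definition trace_on :: "'v::euclidean_space set \<Rightarrow> ('v \<Rightarrow> 'v) \<Rightarrow> real" where
  "trace_on V f = (let B = (SOME B. independent B \<and> span B = V)
     in \<Sum>b\<in>B. representation B (f b) b)"

definition killing_form :: "'m::finite cmat set \<Rightarrow> 'm cmat \<Rightarrow> 'm cmat \<Rightarrow> real" where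
  "killing_form L X Y = trace_on L (\<lambda>Z. lie_bracket X (lie_bracket Y Z))"

definition dual_space :: "'v::real_vector set \<Rightarrow> ('v \<Rightarrow> real) set" where
  "dual_space V = {F \<in> extensional V.
     (\<forall>X\<in>V. \<forall>Y\<in>V. F (X + Y) = F X + F Y) \<and> (\<forall>c. \<forall>X\<in>V. F (c *\<^sub>R X) = c * F X)}"

text \<open>An element of the dual of the Lie algebra of \<open>T\<close> is represented by its coordinate
  vector \<open>\<xi>\<close> in the basis dual to \<^const>\<open>t_basis\<close>. For \<open>V = g_alg\<close> or \<open>V = k_alg\<close>,
  \<open>killing_embed V \<xi>\<close> is the element of the dual of \<open>V\<close> identified with it: its extension
  by zero on the orthogonal of \<open>t_alg\<close> in \<open>V\<close> for the Killing form of \<open>g_alg\<close>.\<close>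

definition killing_embed ::
    "('n::finite + 'n) cmat set \<Rightarrow> real ^ 'n \<Rightarrow> (('n + 'n) cmat \<Rightarrow> real)" where
  "killing_embed V \<xi> = (THE F. F \<in> dual_space V \<and> (\<forall>k. F (t_basis k) = \<xi> $ k) \<and>
     (\<forall>X\<in>V. (\<forall>H\<in>t_alg. killing_form g_alg H X = 0) \<longrightarrow> F X = 0))"

definition killing_vector :: "real ^ 'n::finite \<Rightarrow> ('n + 'n) cmat" where
  "killing_vector \<xi> = (THE H. H \<in> t_alg \<and> (\<forall>k. killing_form g_alg H (t_basis k) = \<xi> $ k))"

text \<open>The Killing form is negative definite on \<^const>\<open>t_alg\<close>. Elements of the dual are real valued
  here (no factor \<open>\<i>\<close> as in complex roots), hence the minus sign giving a scalar product.\<close>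

definition killing_inner :: "real ^ 'n::finite \<Rightarrow> real ^ 'n \<Rightarrow> real" where
  "killing_inner \<xi> \<eta> = - killing_form g_alg (killing_vector \<xi>) (killing_vector \<eta>)"

text \<open>The pairs \<open>i < j\<close> are written as \<open>i \<noteq> j\<close>, which gives the same set of sums.\<close>

definition pos_noncompact_roots :: "(real ^ 'n::finite) set" where
  "pos_noncompact_roots = {axis i 1 + axis j 1 | i j. i \<noteq> j}"

text \<open>In the index type \<open>3\<close> the numeral \<open>3\<close> equals \<open>0\<close>, so its built-in order is not
  \<open>1 < 2 < 3\<close>; the dominance condition is therefore spelled out.\<close>

definition t_dual_plus :: "(real ^ 3) set" where
  "t_dual_plus = {\<xi>. \<xi> $ 1 \<ge> \<xi> $ 2 \<and> \<xi> $ 2 \<ge> \<xi> $ 3}"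

definition rational_weights :: "(real ^ 3) set" where
  "rational_weights = {\<xi>. \<forall>k. \<xi> $ k \<in> \<rat>}"

definition rational_weights_plus :: "(real ^ 3) set" where
  "rational_weights_plus = rational_weights \<inter> t_dual_plus"

definition C_hol :: "(real ^ 3) set" where
  "C_hol = {\<xi> \<in> t_dual_plus. \<forall>\<beta> \<in> pos_noncompact_roots. killing_inner \<xi> \<beta> > 0}"

definition coadjoint ::
    "('n::finite + 'n) cmat \<Rightarrow> (('n + 'n) cmat \<Rightarrow> real) \<Rightarrow> (('n + 'n) cmat \<Rightarrow> real)" where
  "coadjoint M F = restrict (\<lambda>X. F (matrix_inv M ** X ** M)) g_alg"

definition coadjoint_orbit :: "real ^ 'n::finite \<Rightarrow> (('n + 'n) cmat \<Rightarrow> real) set" where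
  "coadjoint_orbit \<Lambda> = {coadjoint M (killing_embed g_alg \<Lambda>) | M. M \<in> SO_star}"

definition kirwan_polyhedron :: "((3 + 3) cmat \<Rightarrow> real) set \<Rightarrow> (real ^ 3) set" where
  "kirwan_polyhedron \<O> =
     {\<xi> \<in> t_dual_plus. killing_embed k_alg \<xi> \<in> (\<lambda>F. restrict F k_alg) ` \<O>}"

end

theory Submission
  imports Defs
begin

text \<open>
  An element \<open>M\<close> of \<open>SO_star\<close> is determined by its upper blocks \<open>a\<close> and \<open>b\<close>, and with \<open>D\<close> the diagonal
  matrix of \<open>\<Lambda>\<close> the restriction to the Lie algebra of \<open>K\<close> of the orbit point given by \<open>M\<close> is the
  hermitian matrix \<open>N = a D a\<^sup>* + b D b\<^sup>*\<close>. The group relations say that \<open>b = a Z\<close> with \<open>Z\<close>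
  antisymmetric and \<open>a (1 - Z Z\<^sup>*) a\<^sup>* = 1\<close>. Since an antisymmetric \<open>3 \<times> 3\<close> matrix is a cross product,
  \<open>det (x - N)\<close> can be computed: \<open>N\<close> is isospectral to \<open>D + r - v v\<^sup>*\<close> for a vector \<open>v\<close> with
  \<open>|v|\<^sup>2 = r\<close>, where the \<open>|v\<^sub>i|\<^sup>2\<close> are arbitrary nonnegative numbers because the sums
  \<open>\<Lambda>\<^sub>i + \<Lambda>\<^sub>j\<close> are positive. So \<open>\<xi>\<close> occurs iff \<open>\<xi> - r\<close> interlaces with \<open>\<Lambda>\<close> from below, where taking
  traces gives \<open>2 r = \<Sum>\<xi> - \<Sum>\<Lambda>\<close>; these are the stated inequalities.

  The Killing form enters through \<open>(2n - 2) Re (tr (X Y))\<close>, which shows that the embeddings of the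
  dual of the Lie algebra of \<open>T\<close> just read off diagonal entries.
\<close>

subsection \<open>Matrix algebra\<close>

text \<open>What makes the determinant tractable is that phases drop out. With
  \<open>s = 1 - t_1 - t_2 - t_3\<close>, which is positive because \<open>1 - Z Z\<^sup>*\<close>
  is positive definite, one finds \<open>|v_i|^2 = t_i (\<Lambda>_j + \<Lambda>_k) / s\<close>; here
  \<open>r\<close> is the sum of these numbers. For the converse a real \<open>Z\<close> therefore
  suffices: then \<open>a\<close> is an explicit real matrix, \<open>N\<close> is real symmetric,
  and a real orthogonal matrix, which lies in \<open>K\<close>, diagonalises it. The spectrum of
  \<open>N\<close> decides everything because left multiplication of \<open>M\<close> by
  \<open>K\<close> conjugates \<open>N\<close> by a unitary matrix. The Lie algebras are sets of
  velocities of curves and the Killing form is a trace over an unspecified basis, so both must first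
  be made explicit. Cayley transforms provide the curves, being rational in the matrix.\<close>

lemma sum_UNIV_Plus:
  fixes f :: "'a::finite + 'b::finite \<Rightarrow> 'c::comm_monoid_add"
  shows "(\<Sum>x\<in>UNIV. f x) = (\<Sum>i\<in>UNIV. f (Inl i)) + (\<Sum>i\<in>UNIV. f (Inr i))"
  unfolding UNIV_Plus_UNIV[symmetric] by (subst sum.Plus) (auto simp: o_def)

lemma matrix_mult_nth:
  "((A::'a::semiring_1^'n^'m) ** (B::'a^'p^'n)) $ i $ j = (\<Sum>k\<in>UNIV. A $ i $ k * B $ k $ j)"
  by (simp add: matrix_matrix_mult_def)

lemma mat_nth: "mat c $ i $ j = (if i = j then c else 0)"
  by (simp add: mat_def)

lemma mat_mult_nth [simp]:
  "(mat c ** (A::'a::semiring_1^'n^'m)) $ i $ j = c * A $ i $ j"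
  "((A::'a::semiring_1^'n^'m) ** mat c) $ i $ j = A $ i $ j * c"
  by (simp_all add: matrix_mult_nth mat_def if_distrib if_distribR sum.delta sum.delta' cong: if_cong)

lemma bounded_bilinear_matrix_mult:
  "bounded_bilinear ((**) :: complex^'n^'m \<Rightarrow> complex^'p^'n \<Rightarrow> complex^'p^'m)"
  unfolding bilinear_conv_bounded_bilinear[symmetric] bilinear_def
  by (auto intro!: linearI simp: vec_eq_iff matrix_mult_nth sum.distrib algebra_simps scaleR_sum_right)

text \<open>Provides the product rule for curves of matrices, besides the linearity rules gathered
  in \<open>mm_simps\<close>.\<close>

global_interpretation mm:
  bounded_bilinear "(**) :: complex^'n^'m \<Rightarrow> complex^'p^'n \<Rightarrow> complex^'p^'m"
  by (rule bounded_bilinear_matrix_mult)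

lemmas mm_simps = mm.add_left mm.add_right mm.diff_left mm.diff_right mm.minus_left mm.minus_right
  mm.scaleR_left mm.scaleR_right mm.zero_left mm.zero_right matrix_mul_assoc

lemma conj_mat_nth [simp]: "conj_mat M $ i $ j = cnj (M $ i $ j)"
  by (simp add: conj_mat_def)

lemma transpose_nth [simp]: "transpose M $ i $ j = M $ j $ i"
  by (simp add: transpose_def)

lemma hermitian_adjoint_nth [simp]: "hermitian_adjoint M $ i $ j = cnj (M $ j $ i)"
  by (simp add: hermitian_adjoint_def)

lemma conj_mat_simps [simp]:
  "conj_mat (A ** B) = conj_mat A ** conj_mat B"
  "conj_mat (A + B) = conj_mat A + conj_mat B"
  "conj_mat (A - B) = conj_mat A - conj_mat B"
  "conj_mat (- A) = - conj_mat A"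
  "conj_mat (r *\<^sub>R A) = r *\<^sub>R conj_mat A"
  "conj_mat (conj_mat A) = A"
  "conj_mat (mat 1) = mat 1"
  "conj_mat 0 = 0"
  by (simp_all add: vec_eq_iff matrix_mult_nth mat_def)

lemma transpose_simps [simp]:
  fixes A B :: "'n::finite cmat"
  shows "transpose (A + B) = transpose A + transpose B"
  "transpose (A - B) = transpose A - transpose B"
  "transpose (- A) = - transpose A"
  "transpose (r *\<^sub>R A) = r *\<^sub>R transpose A"
  "transpose (0::'n cmat) = 0"
  "transpose (mat c :: 'n cmat) = mat c"
  "transpose (conj_mat A) = hermitian_adjoint A"
  "transpose (hermitian_adjoint A) = conj_mat A"
  "conj_mat (transpose A) = hermitian_adjoint A"
  "conj_mat (hermitian_adjoint A) = transpose A"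
  "hermitian_adjoint (conj_mat A) = transpose A"
  "hermitian_adjoint (transpose A) = conj_mat A"
  by (auto simp: vec_eq_iff mat_def)

lemma hermitian_adjoint_simps [simp]:
  "hermitian_adjoint (A ** B) = hermitian_adjoint B ** hermitian_adjoint A"
  "hermitian_adjoint (A + B) = hermitian_adjoint A + hermitian_adjoint B"
  "hermitian_adjoint (A - B) = hermitian_adjoint A - hermitian_adjoint B"
  "hermitian_adjoint (- A) = - hermitian_adjoint A"
  "hermitian_adjoint (r *\<^sub>R A) = r *\<^sub>R hermitian_adjoint A"
  "hermitian_adjoint (hermitian_adjoint A) = A"
  "hermitian_adjoint (mat 1) = mat 1"
  "hermitian_adjoint 0 = 0"
  by (auto simp: vec_eq_iff matrix_mult_nth mat_def mult.commute)

lemma bounded_linear_hermitian_adjoint: "bounded_linear (hermitian_adjoint :: 'n::finite cmat \<Rightarrow> _)"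
  by (auto intro!: linearI simp: linear_conv_bounded_linear[symmetric])

lemma bounded_linear_transpose: "bounded_linear (transpose :: 'n::finite cmat \<Rightarrow> _)"
  by (auto intro!: linearI simp: linear_conv_bounded_linear[symmetric])

lemma transpose_mult [simp]:
  "transpose (A ** B) = transpose B ** transpose (A :: 'n::finite cmat)"
  by (simp add: matrix_transpose_mul)

text \<open>Positivity enters the proof only in this form: a vector is tested by placing it in a row
  of \<open>B\<close>.\<close>

lemma gram_diag_nonneg: "Re ((B ** hermitian_adjoint B) $ i $ i) \<ge> 0"
proof -
  have "(B ** hermitian_adjoint B) $ i $ i = (\<Sum>k\<in>UNIV. of_real ((cmod (B $ i $ k))\<^sup>2))"
    unfolding matrix_mult_nth by (intro sum.cong refl) (simp add: complex_norm_square del: of_real_power)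
  then show ?thesis by (simp add: sum_nonneg)
qed

lemma matrix_inv_eqI:
  fixes A B :: "'a::field^'n^'n"
  assumes "A ** B = mat 1"
  shows "matrix_inv A = B"
proof -
  have BA: "B ** A = mat 1"
    using assms matrix_left_right_inverse by blast
  have "A ** matrix_inv A = mat 1 \<and> matrix_inv A ** A = mat 1"
    unfolding matrix_inv_def by (rule someI) (use assms BA in auto)
  then show ?thesis
    by (metis BA matrix_mul_assoc matrix_mul_lid matrix_mul_rid)
qed

section \<open>Block matrices\<close>

lemma block_nth [simp]:
  "block A B C D $ Inl i $ Inl j = A $ i $ j"
  "block A B C D $ Inl i $ Inr j = B $ i $ j"
  "block A B C D $ Inr i $ Inl j = C $ i $ j"
  "block A B C D $ Inr i $ Inr j = D $ i $ j"
  by (simp_all add: block_def)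

lemma sum_mat_eq_iff:
  fixes M N :: "('n::finite + 'n) cmat"
  shows "M = N \<longleftrightarrow> (\<forall>i j. M $ Inl i $ Inl j = N $ Inl i $ Inl j \<and> M $ Inl i $ Inr j = N $ Inl i $ Inr j \<and>
     M $ Inr i $ Inl j = N $ Inr i $ Inl j \<and> M $ Inr i $ Inr j = N $ Inr i $ Inr j)"
  unfolding vec_eq_iff by (auto simp: split_sum_all)

lemma block_eq_iff [simp]:
  "block A B C D = block A' B' C' D' \<longleftrightarrow> A = A' \<and> B = B' \<and> C = C' \<and> D = D'"
  unfolding sum_mat_eq_iff by (auto simp: vec_eq_iff)

lemma block_exhaust:
  obtains A B C D where "M = block A B C D"
proof
  show "M = block (\<chi> i j. M $ Inl i $ Inl j) (\<chi> i j. M $ Inl i $ Inr j)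
     (\<chi> i j. M $ Inr i $ Inl j) (\<chi> i j. M $ Inr i $ Inr j)"
    unfolding sum_mat_eq_iff by simp
qed

lemma block_simps [simp]:
  "block A B C D ** block A' B' C' D' =
    block (A ** A' + B ** C') (A ** B' + B ** D') (C ** A' + D ** C') (C ** B' + D ** D')"
  "block A B C D + block A' B' C' D' = block (A + A') (B + B') (C + C') (D + D')"
  "block A B C D - block A' B' C' D' = block (A - A') (B - B') (C - C') (D - D')"
  "- block A B C D = block (- A) (- B) (- C) (- D)"
  "r *\<^sub>R block A B C D = block (r *\<^sub>R A) (r *\<^sub>R B) (r *\<^sub>R C) (r *\<^sub>R D)"
  "conj_mat (block A B C D) = block (conj_mat A) (conj_mat B) (conj_mat C) (conj_mat D)"
  "transpose (block A B C D) = block (transpose A) (transpose C) (transpose B) (transpose D)"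
  "hermitian_adjoint (block A B C D) = block (hermitian_adjoint A) (hermitian_adjoint C)
     (hermitian_adjoint B) (hermitian_adjoint D)"
  unfolding sum_mat_eq_iff by (simp_all add: matrix_mult_nth sum_UNIV_Plus)

lemma mat_block: "mat c = block (mat c) 0 0 (mat c)"
  and zero_block: "0 = block 0 0 0 0"
  unfolding sum_mat_eq_iff by (simp_all add: mat_def)

lemma trace_block: "trace (block A B C D) = trace A + trace D"
  by (simp add: trace_def sum_UNIV_Plus)

lemma trace_minus: "trace (- A) = - trace (A :: 'n::finite cmat)"
  by (simp add: trace_def sum_negf)

lemma trace_conj_mat: "trace (conj_mat A) = cnj (trace A)"
  by (simp add: trace_def)

lemma trace_transpose: "trace (transpose A) = trace A"
  by (simp add: trace_def)

lemma det_conj_mat: "det (conj_mat A) = cnj (det A)"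
  by (simp add: det_def)

lemma det_hermitian_adjoint: "det (hermitian_adjoint A) = cnj (det A)"
  by (metis det_conj_mat det_transpose hermitian_adjoint_def)

subsection \<open>The groups\<close>

abbreviation J_mat :: "('n::finite + 'n) cmat" where
  "J_mat \<equiv> block (mat 1) 0 0 (- mat 1)"

abbreviation S_mat :: "('n::finite + 'n) cmat" where
  "S_mat \<equiv> block 0 (mat 1) (mat 1) 0"

lemma det_block_diag_mult:
  "det (block (A ** B) 0 0 (mat 1)) = det (block A 0 0 (mat 1)) * det (block B 0 0 (mat 1))"
  by (simp add: det_mul[symmetric])

text \<open>Conjugation by the swap \<open>S_mat\<close> moves \<open>B\<close> to the upper corner,
  and the swap squares to 1. Determinants over \<open>'n + 'n\<close> are never compared with
  determinants over \<open>'n\<close>; later proofs rely on multiplicativity and on the effect of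
  conjugation and transposition.\<close>

lemma det_block_diag:
  "det (block A 0 0 B) = det (block A 0 0 (mat 1)) * det (block B 0 0 (mat 1))"
proof -
  have "det (S_mat :: ('a + 'a) cmat) * det (S_mat :: ('a + 'a) cmat) = 1"
    by (simp add: det_mul[symmetric] mat_block[symmetric])
  moreover have "block A 0 0 B = block A 0 0 (mat 1) ** (S_mat ** block B 0 0 (mat 1) ** S_mat)"
    by simp
  ultimately show ?thesis
    by (simp only: det_mul) simp
qed

text \<open>\<^term>\<open>block a b (- b) a\<close> is conjugate to \<open>block (a + \<i> b) 0 0 (a - \<i> b)\<close>.\<close>

lemma det_block_rotation:
  fixes a b :: "'n::finite cmat"
  assumes "a ** a + b ** b = mat 1" and "a ** b = b ** a"
  shows "det (block a b (- b) a) = 1"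
proof -
  define I where "I = (mat \<i> :: 'n cmat)"
  have comm: "I ** X = X ** I" and II: "I ** I = - mat 1" for X
    by (simp_all add: I_def vec_eq_iff mult.commute mat_nth)
  have XII: "X ** I ** I = - X" for X
    by (metis II matrix_mul_assoc matrix_mul_rid mm.minus_right)
  \<comment> \<open>The columns are the eigenvectors (1, i) and (1, -i) of a plane rotation, with
    matrices as scalars; \<open>W'\<close> is the inverse.\<close>
  define W where "W = block (mat 1) (mat 1) I (- I)"
  define W' where "W' = (1/2) *\<^sub>R block (mat 1) (- I) (mat 1) I"
  have "W ** W' = block (mat 1) 0 0 (mat 1)"
    by (simp add: W_def W'_def mm_simps II scaleR_2[symmetric] flip: scaleR_add_right)
  then have W: "W ** W' = mat 1"
    by (simp add: mat_block[symmetric])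
  have W1: "det W * det W' = 1"
    by (simp add: det_mul[symmetric] W)
  define p q where "p = a + b ** I" and "q = a - b ** I"
  have "W ** block p 0 0 q ** W' = block a b (- b) a"
    by (simp add: W_def W'_def p_def q_def mm_simps comm[of a] comm[of b] XII)
       (simp add: scaleR_diff_right scaleR_add_right flip: scaleR_2)
  then have "det (block a b (- b) a) = det (block p 0 0 q) * (det W * det W')"
    by (metis det_mul mult.assoc mult.commute)
  also have "\<dots> = det (block (p ** q) 0 0 (mat 1))"
    by (simp add: W1 det_block_diag[of p q] det_block_diag_mult)
  also have "p ** q = mat 1"
  proof -
    have "b ** I ** b ** I = - (b ** b)" "a ** b ** I = b ** I ** a"
      by (metis XII comm matrix_mul_assoc) (metis assms(2) comm matrix_mul_assoc)
    then have "p ** q = a ** a + b ** b"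
      by (simp add: p_def q_def mm_simps)
    then show ?thesis using assms(1) by simp
  qed
  finally show ?thesis
    by (simp add: mat_block[symmetric])
qed

subsection \<open>Lie algebras\<close>

text \<open>The determinant is continuous in \<open>s\<close> and equals 1 at
  \<open>s = 0\<close>.\<close>

lemma matrix_left_invertible_near_id:
  fixes X :: "'m::finite cmat"
  shows "eventually (\<lambda>s. \<exists>R. R ** (mat 1 - s *\<^sub>R X) = mat 1) (at (0::real))"
proof -
  have "((\<lambda>s. det (mat 1 - s *\<^sub>R X)) \<longlongrightarrow> det (mat 1 - 0 *\<^sub>R X)) (at (0::real))"
    unfolding det_def by (intro tendsto_intros)
  then have "eventually (\<lambda>s. det (mat 1 - s *\<^sub>R X) \<noteq> 0) (at (0::real))"
    by (rule tendsto_imp_eventually_ne) simp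
  then show ?thesis
    by eventually_elim (metis invertible_def invertible_det_nz)
qed

text \<open>The curve is the Cayley transform of \<open>s/2 X\<close> near \<open>s = 0\<close>.\<close>

lemma mem_lie_algebra_cayley:
  fixes X :: "'m::finite cmat"
  assumes one: "mat 1 \<in> G"
    and cay: "\<And>s R. R ** (mat 1 - s *\<^sub>R X) = mat 1 \<Longrightarrow> R ** (mat 1 + s *\<^sub>R X) \<in> G"
  shows "X \<in> lie_algebra G"
proof -
  define P where "P s R \<longleftrightarrow> R ** (mat 1 - s *\<^sub>R X) = mat 1" for s R
  define R where "R s = (SOME R. P (s/2) R)" for s
  \<comment> \<open>The curve must stay in \<open>G\<close> for every real \<open>s\<close>, so it
    is set to 1 wherever the inverse fails to exist.\<close>
  define \<gamma> where "\<gamma> s = (if P (s/2) (R s) then R s ** (mat 1 + (s/2) *\<^sub>R X) else mat 1)" for s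
  have "P 0 (mat 1)" by (simp add: P_def)
  then have "P 0 (R 0)" unfolding R_def using someI[of "P 0"] by simp
  then have "\<gamma> 0 = mat 1" by (simp add: \<gamma>_def P_def)
  moreover have "\<gamma> s \<in> G" for s
    using one cay by (simp add: \<gamma>_def P_def)
  moreover have "(\<gamma> has_vector_derivative X) (at 0)"
  proof -
    obtain K where K: "K > 0" "\<And>(A :: 'm cmat) (B :: 'm cmat). norm (A ** B) \<le> norm A * norm B * K"
      using mm.pos_bounded by blast
    have "eventually (\<lambda>s. \<exists>R. P s R) (at 0)"
      unfolding P_def by (rule matrix_left_invertible_near_id)
    moreover have "filterlim (\<lambda>s::real. s/2) (at 0) (at 0)"
      by (auto simp: filterlim_at eventually_at_filter intro!: tendsto_eq_intros)
    ultimately have "eventually (\<lambda>s. \<exists>R. P (s/2) R) (at 0)"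
      by (rule eventually_compose_filterlim)
    then have ev1: "eventually (\<lambda>s. P (s/2) (R s)) (at 0)"
      by eventually_elim (auto simp: R_def intro: someI_ex)
    have "((\<lambda>s::real. norm ((s/2) *\<^sub>R X) * K) \<longlongrightarrow> 0) (at 0)"
      by (auto intro!: tendsto_eq_intros)
    then have ev2: "eventually (\<lambda>s::real. norm ((s/2) *\<^sub>R X) * K < 1/2) (at 0)"
      by (rule order_tendstoD) simp
    \<comment> \<open>The remainder is \<open>s\<close> times \<open>R s ** Y ** X\<close> with
      \<open>Y\<close> half of \<open>s *\<^sub>R X\<close>; the constant combines the bound
      \<open>2 * norm (mat 1)\<close> for \<open>R s\<close> with two uses of
      \<open>K\<close>.\<close>
    define C where "C = (2 * norm (mat 1 :: 'm cmat)) * norm X * K * norm X * K"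
    have "eventually (\<lambda>s. norm (norm (\<gamma> (0 + s) - \<gamma> 0 - s *\<^sub>R X) / norm s) \<le> C * \<bar>s\<bar>) (at 0)"
      using ev1 ev2 eventually_neq_at_within[of "0::real" 0 UNIV]
    proof eventually_elim
      case (elim s)
      define Y where "Y = (s/2) *\<^sub>R X"
      \<comment> \<open>Since \<open>norm Y * K < 1/2\<close>, this equation bounds the norm of
        \<open>R s\<close> by \<open>norm (mat 1)\<close> plus half of itself.\<close>
      have RY: "R s = mat 1 + R s ** Y"
        using elim(1) by (simp add: P_def Y_def[symmetric] mm_simps algebra_simps)
      have "norm (R s) \<le> norm (mat 1 :: 'm cmat) + norm (R s ** Y)"
        by (subst RY) (rule norm_triangle_ineq)
      also have "norm (R s ** Y) \<le> norm (R s) * (norm Y * K)"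
        using K(2)[of "R s" Y] by (simp add: mult_ac)
      also have "\<dots> \<le> norm (R s) * (1/2)"
        using elim(2) by (intro mult_left_mono) (auto simp: Y_def)
      finally have nR: "norm (R s) \<le> 2 * norm (mat 1 :: 'm cmat)" by simp
      have "\<gamma> s - mat 1 = R s ** (mat 1 + Y) - R s ** (mat 1 - Y)"
        using elim(1) by (simp add: \<gamma>_def P_def Y_def)
      also have "\<dots> = s *\<^sub>R (R s ** X)"
        by (simp add: mm_simps Y_def scaleR_2[symmetric] flip: scaleR_add_left)
      finally have "\<gamma> s - mat 1 - s *\<^sub>R X = s *\<^sub>R ((R s - mat 1) ** X)"
        by (simp add: mm_simps scaleR_diff_right)
      also have "R s - mat 1 = R s ** Y"
        using RY by (metis add_diff_cancel_left')
      finally have "norm (\<gamma> s - mat 1 - s *\<^sub>R X) = \<bar>s\<bar> * norm (R s ** Y ** X)" by simp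
      also have "norm (R s ** Y ** X) \<le> norm (R s ** Y) * norm X * K" by (rule K)
      also have "\<dots> \<le> (norm (R s) * norm Y * K) * norm X * K"
        using K by (intro mult_right_mono) auto
      also have "\<dots> \<le> ((2 * norm (mat 1 :: 'm cmat)) * norm Y * K) * norm X * K"
        using K nR by (intro mult_right_mono) auto
      also have "\<dots> = C * \<bar>s\<bar> / 2" by (simp add: C_def Y_def)
      also have "\<dots> \<le> C * \<bar>s\<bar>" using K by (simp add: C_def)
      finally have "norm (\<gamma> s - mat 1 - s *\<^sub>R X) \<le> \<bar>s\<bar> * (C * \<bar>s\<bar>)"
        by (simp add: mult_left_mono)
      then show ?case
        using elim(3) \<open>\<gamma> 0 = mat 1\<close> by (simp add: divide_simps mult_ac)
    qed
    moreover have "((\<lambda>s. C * \<bar>s\<bar>) \<longlongrightarrow> 0) (at 0)"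
      by (auto intro!: tendsto_eq_intros)
    ultimately have "((\<lambda>s. norm (\<gamma> (0 + s) - \<gamma> 0 - s *\<^sub>R X) / norm s) \<longlongrightarrow> 0) (at 0)"
      by (rule Lim_null_comparison)
    then show ?thesis
      unfolding has_vector_derivative_def has_derivative_at
      by (auto intro: bounded_linear_scaleR_left)
  qed
  ultimately show ?thesis unfolding lie_algebra_def by blast
qed

text \<open>Multiplying two curves pointwise adds their velocities at 0, and rescaling time
  multiplies the velocity.\<close>

lemma subspace_lie_algebra:
  fixes G :: "'m::finite cmat set"
  assumes "mat 1 \<in> G" and mult: "\<And>M N. M \<in> G \<Longrightarrow> N \<in> G \<Longrightarrow> M ** N \<in> G"
  shows "subspace (lie_algebra G)"
  unfolding subspace_def
proof (intro conjI ballI allI)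
  show "0 \<in> lie_algebra G"
    unfolding lie_algebra_def using assms(1) by (auto intro!: exI[of _ "\<lambda>_. mat 1"])
next
  fix X Y assume "X \<in> lie_algebra G" "Y \<in> lie_algebra G"
  then obtain \<gamma> \<delta> where *: "\<And>s. \<gamma> s \<in> G" "\<gamma> 0 = mat 1" "(\<gamma> has_vector_derivative X) (at 0)"
    "\<And>s. \<delta> s \<in> G" "\<delta> 0 = mat 1" "(\<delta> has_vector_derivative Y) (at 0)"
    unfolding lie_algebra_def by blast
  have "((\<lambda>s. \<gamma> s ** \<delta> s) has_vector_derivative X + Y) (at 0)"
    using mm.has_vector_derivative[OF *(3,6)] *(2,5) by (simp add: add.commute)
  then show "X + Y \<in> lie_algebra G"
    unfolding lie_algebra_def using * mult by (auto intro!: exI[of _ "\<lambda>s. \<gamma> s ** \<delta> s"])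
next
  fix c :: real and X assume "X \<in> lie_algebra G"
  then obtain \<gamma> where *: "\<And>s. \<gamma> s \<in> G" "\<gamma> 0 = mat 1" "(\<gamma> has_vector_derivative X) (at 0)"
    unfolding lie_algebra_def by blast
  have "((\<lambda>s::real. c * s) has_vector_derivative c) (at 0)"
    by (auto intro!: derivative_eq_intros simp: has_real_derivative_iff_has_vector_derivative[symmetric])
  then have "((\<gamma> \<circ> (\<lambda>s. c * s)) has_vector_derivative c *\<^sub>R X) (at 0)"
    by (rule vector_diff_chain_at) (use * in simp)
  then show "c *\<^sub>R X \<in> lie_algebra G"
    unfolding lie_algebra_def using * by (auto intro!: exI[of _ "\<gamma> \<circ> (\<lambda>s. c * s)"])
qed

lemma lie_algebra_linear_eq_0:
  assumes "X \<in> lie_algebra G" and L: "bounded_linear L" and "\<And>M. M \<in> G \<Longrightarrow> L M = 0"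
  shows "L X = 0"
proof -
  obtain \<gamma> where *: "\<And>s. \<gamma> s \<in> G" "\<gamma> 0 = mat 1" "(\<gamma> has_vector_derivative X) (at 0)"
    using assms(1) unfolding lie_algebra_def by blast
  have "((\<lambda>s. L (\<gamma> s)) has_vector_derivative L X) (at 0)"
    by (rule bounded_linear.has_vector_derivative[OF L *(3)])
  moreover have "(\<lambda>s. L (\<gamma> s)) = (\<lambda>s. 0)"
    using * assms(3) by auto
  ultimately show ?thesis
    using vector_derivative_unique_at has_vector_derivative_const by metis
qed

text \<open>The invariance of \<open>Q\<close> is differentiated at 0 along the curve by the product
  rule.\<close>

lemma lie_algebra_form_eq_0:
  fixes Q :: "'m::finite cmat"
  assumes "X \<in> lie_algebra G" and t: "bounded_linear t" "t (mat 1) = mat 1"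
    and "\<And>M. M \<in> G \<Longrightarrow> t M ** Q ** M = Q"
  shows "t X ** Q + Q ** X = 0"
proof -
  obtain \<gamma> where *: "\<And>s. \<gamma> s \<in> G" "\<gamma> 0 = mat 1" "(\<gamma> has_vector_derivative X) (at 0)"
    using assms(1) unfolding lie_algebra_def by blast
  have "((\<lambda>s. t (\<gamma> s) ** Q) has_vector_derivative t X ** Q) (at 0)"
    by (intro bounded_linear.has_vector_derivative[OF mm.bounded_linear_left]
        bounded_linear.has_vector_derivative[OF t(1)] *(3))
  from mm.has_vector_derivative[OF this *(3)]
  have "((\<lambda>s. t (\<gamma> s) ** Q ** \<gamma> s) has_vector_derivative Q ** X + t X ** Q) (at 0)"
    using * t(2) by simp
  moreover have "(\<lambda>s. t (\<gamma> s) ** Q ** \<gamma> s) = (\<lambda>s. Q)"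
    using * assms(4) by auto
  ultimately have "Q ** X + t X ** Q = 0"
    using vector_derivative_unique_at has_vector_derivative_const by metis
  then show ?thesis by (simp add: add.commute)
qed

lemma cayley_commute:
  fixes R Y :: "'m::finite cmat"
  assumes "R ** (mat 1 - Y) = mat 1"
  shows "(mat 1 - Y) ** R = mat 1" "R ** (mat 1 + Y) = (mat 1 + Y) ** R"
proof -
  show *: "(mat 1 - Y) ** R = mat 1"
    using assms matrix_left_right_inverse by blast
  have "R ** Y = Y ** R"
    using assms * by (simp add: mm_simps)  (metis add.commute add_diff_cancel_left' diff_add_cancel)
  then show "R ** (mat 1 + Y) = (mat 1 + Y) ** R"
    by (simp add: mm_simps)
qed

text \<open>The hypotheses on \<open>t\<close> cover the transpose and the hermitian adjoint.\<close>

lemma cayley_form: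
  fixes Q R Y :: "'m::finite cmat"
  assumes R: "R ** (mat 1 - Y) = mat 1" and Y: "t Y ** Q + Q ** Y = 0"
    and t: "\<And>A B. t (A ** B) = t B ** t A" "\<And>A B. t (A + B) = t A + t B"
      "\<And>A B. t (A - B) = t A - t B" "t (mat 1) = mat 1"
  shows "t (R ** (mat 1 + Y)) ** Q ** (R ** (mat 1 + Y)) = Q"
proof -
  have Y': "t Y ** Q = - (Q ** Y)" using Y by (simp add: eq_neg_iff_add_eq_0)
  \<comment> \<open>Moving \<open>Q\<close> past \<open>Y\<close> turns \<open>Y\<close> into
    \<open>- t Y\<close>, so \<open>1 + Y\<close> becomes \<open>1 - t Y\<close>, which
    \<open>t R\<close> inverts.\<close>
  have "t R ** Q ** (mat 1 + Y) = t R ** (mat 1 - t Y) ** Q"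
    by (simp add: mm_simps) (simp add: Y' mm_simps flip: matrix_mul_assoc)
  also have "t R ** (mat 1 - t Y) = mat 1"
    using arg_cong[OF cayley_commute(1)[OF R], of t] by (simp add: t)
  finally have 1: "t R ** Q ** (mat 1 + Y) = Q" by simp
  have "t (R ** (mat 1 + Y)) ** Q = t R ** (mat 1 + t Y) ** Q"
    by (simp add: cayley_commute(2)[OF R] t)
  also have "\<dots> = t R ** Q ** (mat 1 - Y)"
    by (simp add: mm_simps) (simp add: Y' mm_simps flip: matrix_mul_assoc)
  finally have "t (R ** (mat 1 + Y)) ** Q ** (R ** (mat 1 + Y)) =
      t R ** Q ** ((mat 1 - Y) ** (mat 1 + Y)) ** R"
    by (simp add: cayley_commute(2)[OF R] matrix_mul_assoc)
  also have "(mat 1 - Y) ** (mat 1 + Y) = (mat 1 + Y) ** (mat 1 - Y)"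
    by (simp add: mm_simps)
  also have "t R ** Q ** ((mat 1 + Y) ** (mat 1 - Y)) ** R =
      (t R ** Q ** (mat 1 + Y)) ** ((mat 1 - Y) ** R)"
    by (simp add: matrix_mul_assoc)
  also have "\<dots> = Q" by (simp add: 1 cayley_commute(1)[OF R])
  finally show ?thesis .
qed

text \<open>Invariance of a form fixes the determinant only up to sign. Here \<open>Q\<close>
  carries \<open>1 + Y\<close> to the transpose of \<open>1 - Y\<close>, so numerator and
  denominator of the Cayley transform have equal determinants.\<close>

lemma det_cayley:
  fixes Q R Y :: "'m::finite cmat"
  assumes R: "R ** (mat 1 - Y) = mat 1" and Y: "transpose Y ** Q + Q ** Y = 0" and Q: "det Q \<noteq> 0"
  shows "det (R ** (mat 1 + Y)) = 1"
proof -
  have Y': "transpose Y ** Q = - (Q ** Y)" using Y by (simp add: eq_neg_iff_add_eq_0)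
  have "Q ** (mat 1 + Y) = transpose (mat 1 - Y) ** Q"
    by (simp add: mm_simps Y')
  then have "det (mat 1 + Y) = det (mat 1 - Y)"
    by (metis Q det_mul det_transpose mult.commute mult_cancel_right)
  then show ?thesis
    by (metis R det_I det_mul)
qed

lemma det_S_mat: "det (S_mat :: ('n::finite + 'n) cmat) \<noteq> 0"
proof -
  have "det (S_mat :: ('n + 'n) cmat) * det (S_mat :: ('n + 'n) cmat) = 1"
    by (simp add: det_mul[symmetric] mat_block[symmetric])
  then show ?thesis by auto
qed

section \<open>The Lie algebra of SO*(2n)\<close>

lemma one_in_SO_star: "mat 1 \<in> SO_star"
  by (simp add: SO_star_def SU_nn_def)

lemma SO_star_mult:
  assumes "M \<in> SO_star" "N \<in> SO_star" shows "M ** N \<in> SO_star"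
proof -
  have "hermitian_adjoint (M ** N) ** J_mat ** (M ** N) =
      hermitian_adjoint N ** (hermitian_adjoint M ** J_mat ** M) ** N"
    by (simp only: hermitian_adjoint_simps matrix_mul_assoc)
  moreover have "transpose (M ** N) ** S_mat ** (M ** N) =
      transpose N ** (transpose M ** S_mat ** M) ** N"
    by (simp only: transpose_mult matrix_mul_assoc)
  ultimately show ?thesis
    using assms by (auto simp: SO_star_def SU_nn_def det_mul)
qed

lemma subspace_g_alg: "subspace g_alg"
  by (rule subspace_lie_algebra[OF one_in_SO_star SO_star_mult])

text \<open>Differentiating the two invariances gives the linear equations; conversely a solution
  has all its Cayley transforms in the group, by \<open>cayley_form\<close> and
  \<open>det_cayley\<close>.\<close>

lemma g_alg_eq:
  "g_alg = {X. hermitian_adjoint X ** J_mat + J_mat ** X = 0 \<and> transpose X ** S_mat + S_mat ** X = 0}"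
proof (intro equalityI subsetI CollectI conjI)
  fix X :: "('a + 'a) cmat" assume X: "X \<in> g_alg"
  show "hermitian_adjoint X ** J_mat + J_mat ** X = 0"
    by (rule lie_algebra_form_eq_0[OF X bounded_linear_hermitian_adjoint])
       (auto simp only: SO_star_def SU_nn_def hermitian_adjoint_simps mem_Collect_eq)
  show "transpose X ** S_mat + S_mat ** X = 0"
    by (rule lie_algebra_form_eq_0[OF X bounded_linear_transpose])
       (auto simp only: SO_star_def SU_nn_def transpose_simps mem_Collect_eq)
next
  fix X :: "('a + 'a) cmat"
  assume X: "X \<in> {X. hermitian_adjoint X ** J_mat + J_mat ** X = 0 \<and>
    transpose X ** S_mat + S_mat ** X = 0}"
  show "X \<in> g_alg"
  proof (rule mem_lie_algebra_cayley[OF one_in_SO_star])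
    fix s R assume R: "R ** (mat 1 - s *\<^sub>R X) = mat 1"
    let ?Y = "s *\<^sub>R X"
    have "hermitian_adjoint ?Y ** J_mat + J_mat ** ?Y = s *\<^sub>R (hermitian_adjoint X ** J_mat + J_mat ** X)"
      by (simp only: hermitian_adjoint_simps mm.scaleR_left mm.scaleR_right scaleR_add_right)
    then have 1: "hermitian_adjoint ?Y ** J_mat + J_mat ** ?Y = 0" using X by simp
    have "transpose ?Y ** S_mat + S_mat ** ?Y = s *\<^sub>R (transpose X ** S_mat + S_mat ** X)"
      by (simp only: transpose_simps mm.scaleR_left mm.scaleR_right scaleR_add_right)
    then have 2: "transpose ?Y ** S_mat + S_mat ** ?Y = 0" using X by simp
    show "R ** (mat 1 + ?Y) \<in> SO_star"
      using cayley_form[where t=hermitian_adjoint, OF R 1] cayley_form[where t=transpose, OF R 2]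
        det_cayley[OF R 2 det_S_mat]
      by (simp add: SO_star_def SU_nn_def)
  qed
qed

section \<open>The group K and its Lie algebra\<close>

text \<open>Equations replace the parametrisation by \<open>U\<close>, so that a Cayley transform
  can be tested for membership without exhibiting its block.\<close>

lemma K_group_eq:
  "K_group = {M. J_mat ** M = M ** J_mat \<and> S_mat ** conj_mat M = M ** S_mat \<and>
     hermitian_adjoint M ** M = mat 1}"
proof (intro equalityI subsetI)
  fix M :: "('a + 'a) cmat"
  assume "M \<in> K_group"
  then obtain U where U: "M = block U 0 0 (conj_mat U)" "hermitian_adjoint U ** U = mat 1"
    by (auto simp: K_group_def unitary_group_def)
  from arg_cong[OF U(2), of conj_mat] have "transpose U ** conj_mat U = mat 1"
    by simp
  with U show "M \<in> {M. J_mat ** M = M ** J_mat \<and> S_mat ** conj_mat M = M ** S_mat \<and>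
     hermitian_adjoint M ** M = mat 1}"
    by (simp add: mm_simps mat_block[symmetric])
next
  fix M :: "('a + 'a) cmat"
  assume M: "M \<in> {M. J_mat ** M = M ** J_mat \<and> S_mat ** conj_mat M = M ** S_mat \<and>
     hermitian_adjoint M ** M = mat 1}"
  obtain A B C D where block: "M = block A B C D" by (rule block_exhaust)
  have "B = - B" "- C = C" "D = conj_mat A"
    using M by (auto simp: block mm_simps)
  then have "B = 0" "C = 0" by (simp_all add: vec_eq_iff eq_neg_iff_add_eq_0 neg_eq_iff_add_eq_0)
  then have "M = block A 0 0 (conj_mat A)" "hermitian_adjoint A ** A = mat 1"
    using M \<open>D = _\<close> by (auto simp: block mat_block)
  then show "M \<in> K_group" by (auto simp: K_group_def unitary_group_def)
qed

lemma lie_algebra_mono: "G \<subseteq> H \<Longrightarrow> lie_algebra G \<subseteq> lie_algebra H"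
  unfolding lie_algebra_def by blast

lemma g_alg_eq_block:
  "g_alg = {block A B (- conj_mat B) (conj_mat A) | A B.
     hermitian_adjoint A = - A \<and> transpose B = - (B :: 'n::finite cmat)}"
proof (intro equalityI subsetI)
  fix X :: "('n + 'n) cmat" assume X: "X \<in> g_alg"
  obtain A B C D where block: "X = block A B C D" by (rule block_exhaust)
  have *: "hermitian_adjoint A = - A" "transpose B = - B" "D = - transpose A" "C = hermitian_adjoint B"
    using X by (auto simp: g_alg_eq block mm_simps zero_block eq_neg_iff_add_eq_0 add.commute)
  have "D = conj_mat A" "C = - conj_mat B"
    using arg_cong[OF *(1), of conj_mat] arg_cong[OF *(2), of conj_mat] *(3,4) by simp_all
  with * show "X \<in> {block A B (- conj_mat B) (conj_mat A) | A B.
     hermitian_adjoint A = - A \<and> transpose B = - B}"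
    by (auto simp: block)
next
  fix X :: "('n + 'n) cmat"
  assume "X \<in> {block A B (- conj_mat B) (conj_mat A) | A B.
     hermitian_adjoint A = - A \<and> transpose B = - B}"
  then obtain A B where AB: "X = block A B (- conj_mat B) (conj_mat A)"
    "hermitian_adjoint A = - A" "transpose B = - B" by blast
  have "transpose A = - conj_mat A" "hermitian_adjoint B = - conj_mat B"
    using arg_cong[OF AB(2), of conj_mat] arg_cong[OF AB(3), of conj_mat] by simp_all
  then show "X \<in> g_alg"
    by (simp add: AB g_alg_eq mm_simps zero_block[symmetric])
qed

lemma g_alg_blockE:
  assumes "X \<in> g_alg"
  obtains A B where "X = block A B (- conj_mat B) (conj_mat A)"
    "hermitian_adjoint A = - A" "transpose B = - B"
    "transpose A = - conj_mat A" "hermitian_adjoint B = - conj_mat B"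
proof -
  obtain A B where AB: "X = block A B (- conj_mat B) (conj_mat A)"
    "hermitian_adjoint A = - A" "transpose B = - B"
    using assms unfolding g_alg_eq_block by blast
  have "transpose A = - conj_mat A" "hermitian_adjoint B = - conj_mat B"
    using arg_cong[OF AB(2), of conj_mat] arg_cong[OF AB(3), of conj_mat] by simp_all
  with AB show thesis by (rule that)
qed

lemma one_in_K_group: "mat 1 \<in> K_group"
  by (simp add: K_group_eq)

lemma K_group_mult:
  assumes "M \<in> K_group" "N \<in> K_group" shows "M ** N \<in> K_group"
proof -
  obtain U V where "M = block U 0 0 (conj_mat U)" "hermitian_adjoint U ** U = mat 1"
    "N = block V 0 0 (conj_mat V)" "hermitian_adjoint V ** V = mat 1"
    using assms by (auto simp: K_group_def unitary_group_def)
  moreover have "hermitian_adjoint (U ** V) ** (U ** V) = hermitian_adjoint V ** (hermitian_adjoint U ** U) ** V"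
    by (simp add: matrix_mul_assoc)
  ultimately show ?thesis
    by (auto simp: K_group_def unitary_group_def intro!: exI[of _ "U ** V"])
qed

lemma subspace_k_alg: "subspace k_alg"
  by (rule subspace_lie_algebra[OF one_in_K_group K_group_mult])

text \<open>For the determinant: the lower block contributes the complex conjugate of what
  \<open>U\<close> contributes, which is the contribution of \<open>hermitian_adjoint U\<close>, and
  \<open>hermitian_adjoint U ** U\<close> is the identity.\<close>

lemma K_group_subset_SO_star: "K_group \<subseteq> SO_star"
proof
  fix M :: "('a + 'a) cmat" assume "M \<in> K_group"
  then obtain U where U: "M = block U 0 0 (conj_mat U)" "hermitian_adjoint U ** U = mat 1"
    by (auto simp: K_group_def unitary_group_def)
  have U': "transpose U ** conj_mat U = mat 1"
    using arg_cong[OF U(2), of conj_mat] by simp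
  have "det M = det (block U 0 0 (mat 1)) * det (block (conj_mat U) 0 0 (mat 1))"
    by (simp add: U(1) det_block_diag[of U "conj_mat U"])
  also have "det (block (conj_mat U) 0 0 (mat 1)) = cnj (det (block U 0 0 (mat 1)))"
    by (simp add: det_conj_mat[symmetric])
  also have "\<dots> = det (block (hermitian_adjoint U) 0 0 (mat 1))"
    by (simp add: det_hermitian_adjoint[symmetric])
  also have "det (block U 0 0 (mat 1)) * \<dots> = 1"
    using det_block_diag_mult[of "hermitian_adjoint U" U]
    by (simp add: U(2) mat_block[symmetric] mult.commute)
  finally show "M \<in> SO_star"
    using U U' by (simp add: SO_star_def SU_nn_def mm_simps)
qed

lemma k_alg_subset_g_alg: "k_alg \<subseteq> g_alg"
  by (rule lie_algebra_mono[OF K_group_subset_SO_star])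

text \<open>Transfers commutation with \<open>J_mat\<close>, and the conjugate-twisted commutation
  with \<open>S_mat\<close>, from the denominator of a Cayley transform to its inverse.\<close>

lemma inverse_intertwines:
  fixes P P' R R' W :: "'m::finite cmat"
  assumes "W ** P' = P ** W" "R ** P = mat 1" "P' ** R' = mat 1"
  shows "R ** W = W ** R'"
proof -
  have "R ** W = R ** (W ** P') ** R'"
    using assms(3) by (metis matrix_mul_assoc matrix_mul_rid)
  also have "\<dots> = (R ** P) ** W ** R'"
    by (simp only: assms(1) matrix_mul_assoc)
  finally show ?thesis by (simp add: assms(2))
qed

lemma cayley_in_K_group:
  fixes A :: "'n::finite cmat"
  defines "X \<equiv> block A 0 0 (conj_mat A)"
  assumes A: "hermitian_adjoint A = - A" and R: "R ** (mat 1 - s *\<^sub>R X) = mat 1"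
  shows "R ** (mat 1 + s *\<^sub>R X) \<in> K_group"
proof -
  let ?Y = "s *\<^sub>R X"
  have A': "transpose A = - conj_mat A" using arg_cong[OF A, of conj_mat] by simp
  \<comment> \<open>Unitarity is invariance of the identity form, hence \<open>Q = mat 1\<close> in
    \<open>cayley_form\<close>.\<close>
  have "hermitian_adjoint ?Y ** mat 1 + mat 1 ** ?Y = 0"
    by (simp add: X_def A A' zero_block[symmetric])
  from cayley_form[where t=hermitian_adjoint, OF R this]
  have 1: "hermitian_adjoint (R ** (mat 1 + ?Y)) ** (R ** (mat 1 + ?Y)) = mat 1" by simp
  note R' = cayley_commute(1)[OF R]
  have "J_mat ** (mat 1 - ?Y) = (mat 1 - ?Y) ** J_mat"
    by (simp add: X_def mm_simps)
  from inverse_intertwines[OF this R R'] have J: "R ** J_mat = J_mat ** R" .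
  have "conj_mat (mat 1 - ?Y) ** conj_mat R = mat 1"
    using arg_cong[OF R', of conj_mat] by (simp only: conj_mat_simps)
  moreover have "S_mat ** conj_mat (mat 1 - ?Y) = (mat 1 - ?Y) ** S_mat"
    by (simp add: X_def mm_simps)
  ultimately have S: "R ** S_mat = S_mat ** conj_mat R"
    using inverse_intertwines R by blast
  have J': "J_mat ** (mat 1 + ?Y) = (mat 1 + ?Y) ** J_mat"
    and S': "S_mat ** conj_mat (mat 1 + ?Y) = (mat 1 + ?Y) ** S_mat"
    by (simp_all add: X_def mm_simps)
  have "J_mat ** (R ** (mat 1 + ?Y)) = R ** (J_mat ** (mat 1 + ?Y))"
    by (simp only: matrix_mul_assoc J)
  also have "\<dots> = R ** (mat 1 + ?Y) ** J_mat"
    by (simp only: matrix_mul_assoc J')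
  finally have J'': "J_mat ** (R ** (mat 1 + ?Y)) = R ** (mat 1 + ?Y) ** J_mat" .
  have "S_mat ** conj_mat (R ** (mat 1 + ?Y)) = R ** (S_mat ** conj_mat (mat 1 + ?Y))"
    by (simp only: conj_mat_simps(1) matrix_mul_assoc S)
  also have "\<dots> = R ** (mat 1 + ?Y) ** S_mat"
    by (simp only: matrix_mul_assoc S')
  finally have S'': "S_mat ** conj_mat (R ** (mat 1 + ?Y)) = R ** (mat 1 + ?Y) ** S_mat" .
  from J'' S'' 1 show "R ** (mat 1 + ?Y) \<in> K_group"
    unfolding K_group_eq by blast
qed

lemma block_in_k_alg:
  fixes A :: "'n::finite cmat"
  assumes "hermitian_adjoint A = - A"
  shows "block A 0 0 (conj_mat A) \<in> k_alg"
  using mem_lie_algebra_cayley[OF one_in_K_group] cayley_in_K_group[OF assms] by blast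

lemma k_alg_eq: "k_alg = {block A 0 0 (conj_mat A) | A. hermitian_adjoint A = - (A :: 'n::finite cmat)}"
proof (intro equalityI subsetI)
  fix X :: "('n + 'n) cmat" assume X: "X \<in> k_alg"
  then have "X \<in> g_alg" using k_alg_subset_g_alg by blast
  then obtain A B where AB: "X = block A B (- conj_mat B) (conj_mat A)" "hermitian_adjoint A = - A"
    unfolding g_alg_eq_block by blast
  \<comment> \<open>Elements of \<open>K_group\<close> commute with \<open>J_mat\<close>, so their
    velocities do too, and this kills the off-diagonal block.\<close>
  have "bounded_linear (\<lambda>M. J_mat ** M - M ** J_mat :: ('n + 'n) cmat)"
    by (intro bounded_linear_sub mm.bounded_linear_left mm.bounded_linear_right)
  from lie_algebra_linear_eq_0[OF X this] have "J_mat ** X - X ** J_mat = 0"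
    by (simp add: K_group_eq)
  then have "B + B = 0"
    by (simp add: AB mm_simps zero_block)
  then have "B = 0" by (simp add: vec_eq_iff)
  then show "X \<in> {block A 0 0 (conj_mat A) | A. hermitian_adjoint A = - A}"
    using AB by auto
qed (use block_in_k_alg in auto)

section \<open>The torus and its Lie algebra\<close>

lemma T_group_eq: "T_group = {M \<in> K_group. \<forall>r c. r \<noteq> c \<longrightarrow> M $ r $ c = 0}"
  unfolding T_group_def K_group_def by (auto simp: split_sum_all)

lemma t_basis_nth [simp]:
  "t_basis k $ Inl i $ Inl j = (if i = k \<and> j = k then \<i> else 0)"
  "t_basis k $ Inr i $ Inr j = (if i = k \<and> j = k then - \<i> else 0)"
  "t_basis k $ Inl i $ Inr j = 0"
  "t_basis k $ Inr i $ Inl j = 0"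
  by (simp_all add: t_basis_def Let_def)

lemma diag_in_t_alg:
  fixes X :: "('n::finite + 'n) cmat"
  assumes X: "X \<in> k_alg" and d: "\<And>r c. r \<noteq> c \<Longrightarrow> X $ r $ c = 0"
  shows "X \<in> t_alg"
proof (rule mem_lie_algebra_cayley)
  show "mat 1 \<in> T_group" by (simp add: T_group_eq one_in_K_group mat_nth)
  fix s :: real and R :: "('n + 'n) cmat"
  let ?Y = "s *\<^sub>R X"
  assume R: "R ** (mat 1 - ?Y) = mat 1"
  have dR: "(M ** (mat 1 + a *\<^sub>R X)) $ r $ c = M $ r $ c * (1 + a *\<^sub>R X $ c $ c)" for M a r c
  proof -
    have "(M ** (mat 1 + a *\<^sub>R X)) $ r $ c =
        (\<Sum>k\<in>UNIV. if k = c then M $ r $ c * (1 + a *\<^sub>R X $ c $ c) else 0)"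
      unfolding matrix_mult_nth by (rule sum.cong) (auto simp: mat_nth d)
    then show ?thesis by simp
  qed
  have R0: "R $ r $ c = 0" if "r \<noteq> c" for r c
  proof -
    have "R $ r' $ c * (1 + (- s) *\<^sub>R X $ c $ c) = (if r' = c then 1 else 0)" for r'
      using R unfolding dR[symmetric] by (simp add: mat_nth)
    \<comment> \<open>Row \<open>c\<close> shows that the factor is nonzero; row \<open>r\<close>
      then gives the vanishing entry.\<close>
    from this[of c] this[of r] that show ?thesis by auto
  qed
  then have "\<forall>r c. r \<noteq> c \<longrightarrow> (R ** (mat 1 + ?Y)) $ r $ c = 0"
    by (simp add: dR)
  moreover have "R ** (mat 1 + ?Y) \<in> K_group"
    using X R cayley_in_K_group unfolding k_alg_eq by blast
  ultimately show "R ** (mat 1 + ?Y) \<in> T_group"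
    by (simp add: T_group_eq)
qed

lemma t_alg_eq: "t_alg = {X \<in> k_alg. \<forall>r c. r \<noteq> c \<longrightarrow> X $ r $ c = 0}"
proof (intro equalityI subsetI CollectI conjI allI impI)
  fix X :: "('a + 'a) cmat" and r c :: "'a + 'a" assume X: "X \<in> t_alg"
  show "X \<in> k_alg"
    using X lie_algebra_mono[of T_group K_group] by (auto simp: T_group_eq)
  assume "r \<noteq> c"
  then show "X $ r $ c = 0"
    using lie_algebra_linear_eq_0[OF X, of "\<lambda>M. M $ r $ c"]
    by (auto simp: T_group_eq intro: bounded_linear_compose[OF bounded_linear_vec_nth bounded_linear_vec_nth])
qed (auto intro: diag_in_t_alg)

lemma t_alg_subset_k_alg: "t_alg \<subseteq> k_alg"
  by (auto simp: t_alg_eq)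

lemma t_basis_in_t_alg: "t_basis k \<in> t_alg"
proof -
  define D :: "'a cmat" where "D = (\<chi> i j. if i = k \<and> j = k then \<i> else 0)"
  have "t_basis k = block D 0 0 (conj_mat D)"
    by (simp only: t_basis_def D_def Let_def)
  moreover have "hermitian_adjoint D = - D"
    by (auto simp: vec_eq_iff D_def)
  ultimately show ?thesis
    unfolding t_alg_eq k_alg_eq by (auto simp: split_sum_all D_def)
qed

subsection \<open>The Killing form\<close>

definition elem_mat :: "'m::finite \<Rightarrow> 'm \<Rightarrow> complex \<Rightarrow> 'm cmat" where
  "elem_mat r c z = (\<chi> i j. if i = r \<and> j = c then z else 0)"

text \<open>The trace of a real linear map of the whole matrix space, in the real basis of the
  \<open>elem_mat r c 1\<close> and \<open>elem_mat r c \<i>\<close>.\<close>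

definition real_trace :: "('m::finite cmat \<Rightarrow> 'm cmat) \<Rightarrow> real" where
  "real_trace g = (\<Sum>r\<in>UNIV. \<Sum>c\<in>UNIV.
     Re (g (elem_mat r c 1) $ r $ c) + Im (g (elem_mat r c \<i>) $ r $ c))"

lemma cmat_expansion:
  fixes Y :: "'m::finite cmat"
  shows "Y = (\<Sum>r\<in>UNIV. \<Sum>c\<in>UNIV.
    Re (Y $ r $ c) *\<^sub>R elem_mat r c 1 + Im (Y $ r $ c) *\<^sub>R elem_mat r c \<i>)" (is "_ = ?E")
proof -
  have "?E $ i $ j = Y $ i $ j" for i j
  proof -
    have "?E $ i $ j = (\<Sum>r\<in>UNIV. \<Sum>c\<in>UNIV.
        (Re (Y $ r $ c) *\<^sub>R elem_mat r c 1 + Im (Y $ r $ c) *\<^sub>R elem_mat r c \<i>) $ i $ j)"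
      by (simp only: sum_component)
    also have "\<dots> = (\<Sum>r\<in>UNIV. \<Sum>c\<in>UNIV. if j = c then (if i = r then Y $ r $ c else 0) else 0)"
      by (intro sum.cong refl complex_eqI) (auto simp: elem_mat_def)
    also have "\<dots> = Y $ i $ j"
      by (simp add: sum.delta')
    finally show ?thesis .
  qed
  then show ?thesis by (simp add: vec_eq_iff)
qed

text \<open>The trace on \<open>V\<close> is the trace on the whole space of the extension by any projection onto \<open>V\<close>.\<close>

lemma trace_on_eq_real_trace:
  fixes V :: "'m::finite cmat set"
  assumes V: "subspace V" and f: "linear f" "\<And>v. v \<in> V \<Longrightarrow> f v \<in> V"
    and P: "linear P" "\<And>Y. P Y \<in> V" "\<And>v. v \<in> V \<Longrightarrow> P v = v"
  shows "trace_on V f = real_trace (\<lambda>Y. f (P Y))"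
proof -
  define B where "B = (SOME B. independent B \<and> span B = V)"
  have "\<exists>B. independent B \<and> span B = V"
    using maximal_independent_subset[of V] V by (metis span_mono span_eq_iff subset_antisym)
  then have "independent B \<and> span B = V"
    unfolding B_def by (rule someI_ex)
  then have B: "independent B" "span B = V" "finite B"
    by (auto intro: finiteI_independent)
  \<comment> \<open>The composite of \<open>f\<close> and \<open>P\<close> is a sum of rank one maps
    \<open>Y \<mapsto> \<phi> b Y *\<^sub>R f b\<close>, whose traces are
    \<open>\<phi> b (f b)\<close>.\<close>
  define \<phi> where "\<phi> b Y = representation B (P Y) b" for b Y
  have lin: "linear (\<phi> b)" for b
    unfolding \<phi>_def
    using P B by (auto intro!: linearI simp: linear_add linear_scale representation_add representation_scale)
  have fP: "f (P Y) = (\<Sum>b\<in>B. \<phi> b Y *\<^sub>R f b)" for Y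
  proof -
    have "P Y = (\<Sum>b\<in>B. \<phi> b Y *\<^sub>R b)"
      unfolding \<phi>_def using sum_representation_eq[OF B(1) _ B(3) order_refl, of "P Y"] P B by auto
    then have "f (P Y) = f (\<Sum>b\<in>B. \<phi> b Y *\<^sub>R b)" by simp
    also have "\<dots> = (\<Sum>b\<in>B. \<phi> b Y *\<^sub>R f b)"
      using f(1) by (simp add: linear_sum linear_scale)
    finally show ?thesis .
  qed
  have "real_trace (\<lambda>Y. f (P Y)) = (\<Sum>r\<in>UNIV. \<Sum>c\<in>UNIV. \<Sum>b\<in>B.
     \<phi> b (elem_mat r c 1) * Re (f b $ r $ c) + \<phi> b (elem_mat r c \<i>) * Im (f b $ r $ c))"
    unfolding real_trace_def by (simp add: fP sum.distrib)
  also have "\<dots> = (\<Sum>b\<in>B. \<Sum>r\<in>UNIV. \<Sum>c\<in>UNIV.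
     \<phi> b (elem_mat r c 1) * Re (f b $ r $ c) + \<phi> b (elem_mat r c \<i>) * Im (f b $ r $ c))"
    by (subst (2) sum.swap, subst sum.swap) (rule refl)
  also have "\<dots> = (\<Sum>b\<in>B. \<phi> b (f b))"
  proof (rule sum.cong[OF refl])
    fix b
    show "(\<Sum>r\<in>UNIV. \<Sum>c\<in>UNIV. \<phi> b (elem_mat r c 1) * Re (f b $ r $ c) +
       \<phi> b (elem_mat r c \<i>) * Im (f b $ r $ c)) = \<phi> b (f b)"
      by (subst (3) cmat_expansion)
         (simp add: linear_sum[OF lin] linear_add[OF lin] linear_scale[OF lin] mult.commute)
  qed
  also have "\<dots> = (\<Sum>b\<in>B. representation B (f b) b)"
  proof (rule sum.cong[OF refl])
    fix b assume "b \<in> B"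
    then have "f b \<in> V" using f(2) B span_base by blast
    then show "\<phi> b (f b) = representation B (f b) b" by (simp add: \<phi>_def P)
  qed
  also have "\<dots> = trace_on V f" by (simp add: trace_on_def B_def Let_def)
  finally show ?thesis by simp
qed

lemma elem_mat_mult_nth:
  "(A ** elem_mat r c z ** B) $ i $ j = A $ i $ r * z * B $ c $ j"
proof -
  have "(A ** elem_mat r c z) $ i $ k = (if k = c then A $ i $ r * z else 0)" for k
    by (simp add: matrix_mult_nth elem_mat_def if_distrib sum.delta cong: if_cong)
  then have "(A ** elem_mat r c z ** B) $ i $ j = (\<Sum>k\<in>UNIV. if k = c then A $ i $ r * z * B $ k $ j else 0)"
    unfolding matrix_mult_nth[of "A ** elem_mat r c z"] by (intro sum.cong) auto
  then show ?thesis by simp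
qed

lemma elem_mat_simps:
  "transpose (elem_mat r c z) = elem_mat c r z"
  "conj_mat (elem_mat r c z) = elem_mat r c (cnj z)"
  "hermitian_adjoint (elem_mat r c z) = elem_mat c r (cnj z)"
  by (auto simp: vec_eq_iff elem_mat_def)

text \<open>A complex linear map has real trace twice the real part of its complex trace. For a
  conjugate linear map the contributions of \<open>elem_mat r c 1\<close> and
  \<open>elem_mat r c \<i>\<close> cancel.\<close>

lemma real_trace_simps:
  "real_trace (\<lambda>Z. A ** Z ** B) = 2 * Re (trace A * trace B)"
  "real_trace (\<lambda>Z. A ** transpose Z ** B) = 2 * Re (trace (A ** transpose B))"
  "real_trace (\<lambda>Z. A ** conj_mat Z ** B) = 0"
  "real_trace (\<lambda>Z. A ** hermitian_adjoint Z ** B) = 0"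
proof -
  show "real_trace (\<lambda>Z. A ** Z ** B) = 2 * Re (trace A * trace B)"
  proof -
    have "real_trace (\<lambda>Z. A ** Z ** B) = (\<Sum>r\<in>UNIV. \<Sum>c\<in>UNIV. 2 * Re (A $ r $ r * B $ c $ c))"
      unfolding real_trace_def elem_mat_mult_nth by (intro sum.cong refl) (simp add: algebra_simps)
    also have "\<dots> = 2 * Re (trace A * trace B)"
      unfolding trace_def sum_product by (simp only: Re_sum sum_distrib_left)
    finally show ?thesis .
  qed
  show "real_trace (\<lambda>Z. A ** transpose Z ** B) = 2 * Re (trace (A ** transpose B))"
  proof -
    have "real_trace (\<lambda>Z. A ** transpose Z ** B) = (\<Sum>r\<in>UNIV. \<Sum>c\<in>UNIV. 2 * Re (A $ r $ c * B $ r $ c))"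
      unfolding real_trace_def elem_mat_simps elem_mat_mult_nth
      by (intro sum.cong refl) (simp add: algebra_simps)
    also have "\<dots> = 2 * Re (trace (A ** transpose B))"
      unfolding trace_def matrix_mult_nth transpose_nth by (simp only: Re_sum sum_distrib_left)
    finally show ?thesis .
  qed
qed (simp_all add: real_trace_def elem_mat_simps elem_mat_mult_nth)

lemma real_trace_linear:
  "real_trace (\<lambda>Z. f Z + g Z) = real_trace f + real_trace g"
  "real_trace (\<lambda>Z. f Z - g Z) = real_trace f - real_trace g"
  "real_trace (\<lambda>Z. a *\<^sub>R f Z) = a * real_trace f"
  by (simp_all add: real_trace_def sum.distrib sum_subtractf sum_distrib_left algebra_simps)

text \<open>Brings the double bracket into the shapes that \<open>real_trace_simps\<close>
  evaluates; \<open>h\<close> stands for the identity, adjoint, transpose or conjugate in the terms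
  of \<open>g_proj\<close>.\<close>

lemma real_trace_bracket:
  "real_trace (\<lambda>Z. lie_bracket X (lie_bracket Y (A ** h Z ** B))) =
    real_trace (\<lambda>Z. (X ** Y ** A) ** h Z ** B) - real_trace (\<lambda>Z. (X ** A) ** h Z ** (B ** Y))
    - real_trace (\<lambda>Z. (Y ** A) ** h Z ** (B ** X)) + real_trace (\<lambda>Z. A ** h Z ** (B ** Y ** X))"
  unfolding real_trace_linear[symmetric]
  by (rule arg_cong[where f=real_trace]) (auto simp: lie_bracket_def mm_simps)

lemma linear_lie_bracket: "linear (lie_bracket X)"
  by (rule linearI) (simp_all add: lie_bracket_def mm_simps scaleR_diff_right)

lemma g_alg_bracket:
  assumes "X \<in> g_alg" "Y \<in> g_alg" shows "lie_bracket X Y \<in> g_alg"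
proof -
  have *: "t (X ** Y - Y ** X) ** Q + Q ** (X ** Y - Y ** X) = 0"
    if "t X ** Q + Q ** X = 0" "t Y ** Q + Q ** Y = 0"
      "\<And>A B. t (A ** B) = t B ** t A" "\<And>A B. t (A - B) = t A - t B" for t :: "('a + 'a) cmat \<Rightarrow> _" and Q
  proof -
    have 1: "t X ** Q = - (Q ** X)" "t Y ** Q = - (Q ** Y)"
      using that by (simp_all add: eq_neg_iff_add_eq_0)
    have 2: "t A ** (t B ** Q) = Q ** A ** B" if "t A ** Q = - (Q ** A)" "t B ** Q = - (Q ** B)" for A B
    proof -
      have "t A ** (t B ** Q) = - (t A ** Q) ** B"
        by (simp only: that(2) mm.minus_right mm.minus_left matrix_mul_assoc)
      then show ?thesis by (simp add: that(1))
    qed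
    have "t (X ** Y - Y ** X) ** Q = t Y ** (t X ** Q) - t X ** (t Y ** Q)"
      by (simp only: that(3,4) mm.diff_left matrix_mul_assoc)
    also have "\<dots> = - (Q ** (X ** Y - Y ** X))"
      by (simp only: 1 2[OF 1(1) 1(2)] 2[OF 1(2) 1(1)]) (simp add: 2 1 mm_simps)
    finally show ?thesis by simp
  qed
  show ?thesis
    using assms unfolding g_alg_eq lie_bracket_def mem_Collect_eq
    by (intro conjI *) auto
qed

text \<open>The mean over the group of order 4 generated by the commuting involutions
  \<open>Y \<mapsto> - J Y\<^sup>* J\<close> and \<open>Y \<mapsto> - S Y\<^sup>T S\<close>. Their
  common fixed points form \<open>g_alg\<close>, so the mean is a projection onto it.\<close>

definition g_proj :: "('n::finite + 'n) cmat \<Rightarrow> ('n + 'n) cmat" where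
  "g_proj Y = (1/4) *\<^sub>R (mat 1 ** Y ** mat 1 - J_mat ** hermitian_adjoint Y ** J_mat
     - S_mat ** transpose Y ** S_mat + (J_mat ** S_mat) ** conj_mat Y ** (S_mat ** J_mat))"

lemma linear_g_proj: "linear g_proj"
proof -
  have lin: "linear (\<lambda>Y. A ** t Y ** B)"
    if "\<And>X Y. t (X + Y) = t X + t Y" "\<And>c X. t (c *\<^sub>R X) = c *\<^sub>R t X"
    for A B :: "'m::finite cmat" and t :: "'m cmat \<Rightarrow> 'm cmat"
    by (rule linearI) (simp_all only: that mm.add_left mm.add_right mm.scaleR_left mm.scaleR_right)
  show ?thesis
    unfolding g_proj_def
    by (intro linear_compose_scale_right linear_compose_add linear_compose_sub lin) simp_all
qed

lemma g_proj_in_g_alg: "g_proj Y \<in> g_alg"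
proof -
  obtain A B C D where Y: "Y = block A B C D" by (rule block_exhaust)
  define E where "E = (1/4) *\<^sub>R (A - hermitian_adjoint A - transpose D + conj_mat D)"
  define F where "F = (1/4) *\<^sub>R (B + hermitian_adjoint C - transpose B - conj_mat C)"
  have "g_proj Y = block E F (- conj_mat F) (conj_mat E)"
    unfolding sum_mat_eq_iff by (simp add: g_proj_def Y E_def F_def mm_simps algebra_simps)
  moreover have "hermitian_adjoint E = - E" "transpose F = - F"
    by (simp_all add: vec_eq_iff E_def F_def algebra_simps)
  ultimately show ?thesis
    unfolding g_alg_eq_block by blast
qed

lemma g_alg_fixed:
  assumes "X \<in> g_alg"
  shows "J_mat ** hermitian_adjoint X ** J_mat = - X" "S_mat ** transpose X ** S_mat = - X"
    "(J_mat ** S_mat) ** conj_mat X ** (S_mat ** J_mat) = X"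
  using assms by (auto elim!: g_alg_blockE simp: mm_simps)

lemma g_proj_fixed: "X \<in> g_alg \<Longrightarrow> g_proj X = X"
  unfolding g_proj_def by (simp only: g_alg_fixed) (simp add: vec_eq_iff)

text \<open>Of the four terms of \<open>g_proj\<close> the two conjugate linear ones have trace 0.
  The identity contributes \<open>8 n Re tr(X Y)\<close> and the transpose, with a minus sign,
  \<open>8 Re tr(X Y)\<close>; a quarter of the difference is
  \<open>(2 n - 2) Re tr(X Y)\<close>.\<close>

lemma killing_form_g_alg:
  fixes X Y :: "('n::finite + 'n) cmat"
  assumes X: "X \<in> g_alg" and Y: "Y \<in> g_alg"
  shows "killing_form g_alg X Y = (2 * real CARD('n) - 2) * Re (trace (X ** Y))"
proof -
  let ?f = "\<lambda>Z. lie_bracket X (lie_bracket Y Z)"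
  have lin: "linear ?f"
    using linear_compose[OF linear_lie_bracket linear_lie_bracket] by (simp add: o_def)
  have "killing_form g_alg X Y = real_trace (\<lambda>Z. ?f (g_proj Z))"
    unfolding killing_form_def
    by (rule trace_on_eq_real_trace[OF subspace_g_alg lin _ linear_g_proj g_proj_in_g_alg g_proj_fixed])
       (intro g_alg_bracket X Y)
  also have "\<dots> = (1/4) * (real_trace (\<lambda>Z. ?f (mat 1 ** Z ** mat 1))
      - real_trace (\<lambda>Z. ?f (J_mat ** hermitian_adjoint Z ** J_mat))
      - real_trace (\<lambda>Z. ?f (S_mat ** transpose Z ** S_mat))
      + real_trace (\<lambda>Z. ?f ((J_mat ** S_mat) ** conj_mat Z ** (S_mat ** J_mat))))"
    unfolding g_proj_def real_trace_linear(3)[symmetric] real_trace_linear(1,2)[symmetric]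
    by (simp only: linear_scale[OF lin] linear_add[OF lin] linear_diff[OF lin])
  also have "real_trace (\<lambda>Z. ?f (J_mat ** hermitian_adjoint Z ** J_mat)) = 0"
    by (simp only: real_trace_bracket real_trace_simps)
  also have "real_trace (\<lambda>Z. ?f ((J_mat ** S_mat) ** conj_mat Z ** (S_mat ** J_mat))) = 0"
    by (simp only: real_trace_bracket real_trace_simps)
  also have "real_trace (\<lambda>Z. ?f (mat 1 ** Z ** mat 1)) = 8 * real CARD('n) * Re (trace (X ** Y))"
  proof -
    \<comment> \<open>Removes the products \<open>trace X * trace Y\<close> of the mixed terms: a
      skew-hermitian block has imaginary trace, which the conjugate block cancels.\<close>
    have tr0: "trace Z = 0" if Z: "Z \<in> g_alg" for Z :: "('n + 'n) cmat"
    proof -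
      obtain A B where "Z = block A B (- conj_mat B) (conj_mat A)" "hermitian_adjoint A = - A"
        using Z by (blast elim: g_alg_blockE)
      moreover from this(2) have "cnj (trace A) = - trace A"
        by (metis hermitian_adjoint_def trace_conj_mat trace_minus trace_transpose)
      ultimately show ?thesis by (simp add: trace_block trace_conj_mat)
    qed
    have "real_trace (\<lambda>Z. ?f (mat 1 ** Z ** mat 1)) =
        2 * Re (trace (X ** Y) * of_nat CARD('n + 'n)) + 2 * Re (of_nat CARD('n + 'n) * trace (Y ** X))"
      by (simp only: real_trace_bracket[where h="\<lambda>Z. Z"] real_trace_simps)
         (simp add: tr0[OF X] tr0[OF Y] trace_I)
    then show ?thesis
      by (simp add: trace_mul_sym[of Y X] algebra_simps)
  qed
  also have "real_trace (\<lambda>Z. ?f (S_mat ** transpose Z ** S_mat)) = 8 * Re (trace (X ** Y))"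
  proof -
    let ?S = "S_mat :: ('n + 'n) cmat"
    have SS: "?S ** ?S = mat 1" "transpose ?S = ?S" by (simp_all add: mat_block[symmetric])
    have XS: "transpose X ** ?S = - (?S ** X)" "transpose Y ** ?S = - (?S ** Y)"
      using X Y by (auto simp: g_alg_eq eq_neg_iff_add_eq_0)
    have SSZ: "?S ** (?S ** Z) = Z" for Z
      by (simp only: matrix_mul_assoc SS matrix_mul_lid)
    have XSZ: "transpose X ** (?S ** Z) = - (?S ** (X ** Z))" for Z
      by (simp only: matrix_mul_assoc XS mm.minus_left)
    note rules = transpose_mult XS XSZ SS SSZ matrix_mul_assoc[symmetric] mm.minus_right minus_minus matrix_mul_rid
    \<comment> \<open>With these, each of the four terms of the double bracket contributes
      \<open>2 Re tr(X Y)\<close> with a plus sign.\<close>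
    have 1: "X ** Y ** ?S ** transpose ?S = X ** Y"
      and 2: "X ** ?S ** transpose (?S ** Y) = - (X ** Y)"
      and 3: "Y ** ?S ** transpose (?S ** X) = - (Y ** X)"
      and 4: "?S ** transpose (?S ** Y ** X) = X ** Y"
      by (simp_all only: rules)
    show ?thesis
      by (simp only: real_trace_bracket real_trace_simps 1 2 3 4 trace_minus)
         (simp add: trace_mul_sym[of Y X])
  qed
  finally show ?thesis by (simp add: algebra_simps)
qed

subsection \<open>The identifications given by the Killing form\<close>

definition diag_mat :: "real ^ 'n::finite \<Rightarrow> 'n cmat" where
  "diag_mat \<xi> = (\<chi> i j. if i = j then of_real (\<xi> $ i) else 0)"

text \<open>The explicit functional behind \<open>killing_embed\<close>. The coordinate along
  \<open>t_basis k\<close> is an imaginary part because that basis element has diagonal entry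
  \<open>\<i>\<close>.\<close>

definition diag_pairing :: "real ^ 'n::finite \<Rightarrow> ('n + 'n) cmat \<Rightarrow> real" where
  "diag_pairing \<xi> X = (\<Sum>k\<in>UNIV. \<xi> $ k * Im (X $ Inl k $ Inl k))"

lemma diag_mat_nth: "diag_mat \<xi> $ i $ j = (if i = j then of_real (\<xi> $ i) else 0)"
  by (simp add: diag_mat_def)

lemma diag_mat_mult_nth [simp]:
  "(diag_mat \<xi> ** A) $ i $ j = of_real (\<xi> $ i) * A $ i $ j"
  "(A ** diag_mat \<xi>) $ i $ j = A $ i $ j * of_real (\<xi> $ j)"
  by (simp_all add: matrix_mult_nth diag_mat_def if_distrib if_distribR sum.delta sum.delta' cong: if_cong)

lemma diag_mat_simps [simp]:
  "conj_mat (diag_mat \<xi>) = diag_mat \<xi>"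
  "transpose (diag_mat \<xi>) = diag_mat \<xi>"
  "hermitian_adjoint (diag_mat \<xi>) = diag_mat \<xi>"
  by (auto simp: vec_eq_iff diag_mat_def)

lemma diag_pairing_block: "diag_pairing \<xi> (block A B C D) = Im (trace (diag_mat \<xi> ** A))"
  by (simp add: diag_pairing_def trace_def)

lemma linear_diag_pairing: "linear (diag_pairing \<xi>)"
  by (rule linearI) (simp_all add: diag_pairing_def sum.distrib sum_distrib_left algebra_simps)

lemma diag_pairing_t_basis [simp]: "diag_pairing \<xi> (t_basis k) = \<xi> $ k"
  by (simp add: diag_pairing_def if_distrib[of Im] if_distrib[of "(*) _"] sum.delta cong: if_cong)

definition t_elem :: "('n::finite \<Rightarrow> real) \<Rightarrow> ('n + 'n) cmat" where
  "t_elem c = (\<Sum>k\<in>UNIV. c k *\<^sub>R t_basis k)"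

lemma t_elem_nth [simp]:
  "t_elem c $ Inl i $ Inl j = (if i = j then \<i> * of_real (c i) else 0)"
  "t_elem c $ Inr i $ Inr j = (if i = j then - \<i> * of_real (c i) else 0)"
  "t_elem c $ Inl i $ Inr j = 0"
  "t_elem c $ Inr i $ Inl j = 0"
proof -
  have *: "(\<Sum>k\<in>UNIV. c k *\<^sub>R (if i = k \<and> j = k then z else 0)) = (if i = j then c i *\<^sub>R z else 0)" for z :: complex
  proof -
    have "(\<Sum>k\<in>UNIV. c k *\<^sub>R (if i = k \<and> j = k then z else 0)) =
        (\<Sum>k\<in>UNIV. if i = k then (if i = j then c k *\<^sub>R z else 0) else 0)"
      by (intro sum.cong) auto
    then show ?thesis by simp
  qed
  show "t_elem c $ Inl i $ Inl j = (if i = j then \<i> * of_real (c i) else 0)"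
    "t_elem c $ Inr i $ Inr j = (if i = j then - \<i> * of_real (c i) else 0)"
    unfolding t_elem_def sum_component vector_scaleR_component t_basis_nth *
    by (simp_all add: scaleR_conv_of_real)
qed (simp_all add: t_elem_def sum_component)

lemma t_alg_eq_range: "t_alg = range t_elem"
proof (intro equalityI subsetI)
  fix H :: "('a + 'a) cmat" assume H: "H \<in> t_alg"
  then obtain A where A: "H = block A 0 0 (conj_mat A)" "hermitian_adjoint A = - A"
    by (auto simp: t_alg_eq k_alg_eq)
  have "cnj (A $ i $ i) = - A $ i $ i" for i
    using arg_cong[OF A(2), of "\<lambda>M. M $ i $ i"] by simp
  then have "A $ i $ i = \<i> * of_real (Im (A $ i $ i))" for i
    by (simp add: complex_eq_iff)
  moreover have "A $ i $ j = 0" if "i \<noteq> j" for i j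
    using H that A(1) by (auto simp: t_alg_eq split_sum_all)
  ultimately have "H = t_elem (\<lambda>i. Im (A $ i $ i))"
    unfolding sum_mat_eq_iff by (auto simp: A(1) complex_eq_iff)
  then show "H \<in> range t_elem" by blast
next
  fix H :: "('a + 'a) cmat" assume "H \<in> range t_elem"
  moreover have "t_elem c \<in> t_alg" for c :: "'a \<Rightarrow> real"
  proof -
    have "t_elem c \<in> k_alg"
      unfolding t_elem_def using subspace_k_alg t_basis_in_t_alg t_alg_subset_k_alg
      by (intro subspace_sum subspace_scale) auto
    then show ?thesis by (auto simp: t_alg_eq split_sum_all)
  qed
  ultimately show "H \<in> t_alg" by auto
qed

lemma t_elem_in_t_alg [simp]: "t_elem c \<in> t_alg"
  by (simp add: t_alg_eq_range)

lemma t_alg_subset_g_alg: "t_alg \<subseteq> g_alg"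
  using t_alg_subset_k_alg k_alg_subset_g_alg by blast

lemma t_elem_axis: "t_elem (\<lambda>l. if k = l then 1 else 0) = t_basis k"
  unfolding sum_mat_eq_iff by auto

text \<open>Both diagonal blocks contribute equally and the square of \<open>\<i>\<close> gives the
  sign, so the constant is \<open>- 2 (2 n - 2)\<close>. Only diagonal entries of \<open>X\<close>
  are seen by \<open>t_alg\<close>.\<close>

lemma killing_form_t_elem:
  fixes X :: "('n::finite + 'n) cmat"
  assumes X: "X \<in> g_alg"
  shows "killing_form g_alg (t_elem c) X =
    - (4 * real CARD('n) - 4) * (\<Sum>k\<in>UNIV. c k * Im (X $ Inl k $ Inl k))"
proof -
  obtain A B where AB: "X = block A B (- conj_mat B) (conj_mat A)"
    using X by (blast elim: g_alg_blockE)
  have *: "(\<Sum>k\<in>UNIV. (if i = k then z else 0) * f k) = z * f i" for i :: 'n and z :: complex and f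
  proof -
    have "(\<Sum>k\<in>UNIV. (if i = k then z else 0) * f k) = (\<Sum>k\<in>UNIV. if i = k then z * f k else 0)"
      by (intro sum.cong) auto
    then show ?thesis by simp
  qed
  have "trace (t_elem c ** X) = (\<Sum>k\<in>UNIV. of_real (- 2 * (c k * Im (X $ Inl k $ Inl k))))"
    unfolding trace_def matrix_mult_nth sum_UNIV_Plus t_elem_nth * mult_zero_left sum.neutral_const add_0 add_0_right
    unfolding sum.distrib[symmetric] by (intro sum.cong refl) (simp add: AB complex_eq_iff)
  also have "\<dots> = of_real (- 2 * (\<Sum>k\<in>UNIV. c k * Im (X $ Inl k $ Inl k)))"
    by (simp only: sum_distrib_left of_real_sum)
  finally have "Re (trace (t_elem c ** X)) = - 2 * (\<Sum>k\<in>UNIV. c k * Im (X $ Inl k $ Inl k))"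
    by (simp only: Re_complex_of_real)
  moreover have "t_elem c \<in> g_alg" using t_alg_subset_g_alg by auto
  ultimately show ?thesis
    by (simp add: killing_form_g_alg[OF _ X] algebra_simps)
qed

lemma killing_form_t_basis:
  fixes X :: "('n::finite + 'n) cmat"
  assumes X: "X \<in> g_alg"
  shows "killing_form g_alg (t_basis k) X = - (4 * real CARD('n) - 4) * Im (X $ Inl k $ Inl k)"
proof -
  have "(\<Sum>l\<in>UNIV. (if k = l then 1 else 0) * Im (X $ Inl l $ Inl l)) =
      (\<Sum>l\<in>UNIV. if k = l then Im (X $ Inl l $ Inl l) else 0)"
    by (intro sum.cong) auto
  then show ?thesis
    by (simp add: t_elem_axis[symmetric] killing_form_t_elem[OF X])
qed

text \<open>For \<open>n \<ge> 2\<close> the constant \<open>4 n - 4\<close> is nonzero, so the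
  orthogonal of \<open>t_alg\<close> in \<open>V\<close> consists of the matrices with zero
  diagonal. It complements \<open>t_alg\<close> in \<open>V\<close>, which determines the
  functional.\<close>

lemma killing_embed_eq:
  fixes V :: "('n::finite + 'n) cmat set"
  assumes n: "CARD('n) \<ge> 2" and V: "subspace V" "t_alg \<subseteq> V" "V \<subseteq> g_alg"
  shows "killing_embed V \<xi> = restrict (diag_pairing \<xi>) V"
proof -
  have t: "t_basis k \<in> V" for k using t_basis_in_t_alg V by blast
  show ?thesis
    unfolding killing_embed_def
  proof (rule the_equality)
    show "restrict (diag_pairing \<xi>) V \<in> dual_space V \<and>
      (\<forall>k. restrict (diag_pairing \<xi>) V (t_basis k) = \<xi> $ k) \<and>
      (\<forall>X\<in>V. (\<forall>H\<in>t_alg. killing_form g_alg H X = 0) \<longrightarrow> restrict (diag_pairing \<xi>) V X = 0)"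
    proof (intro conjI ballI impI allI)
      show "restrict (diag_pairing \<xi>) V \<in> dual_space V"
        using V(1) linear_diag_pairing[of \<xi>]
        by (auto simp: dual_space_def subspace_add subspace_scale linear_add linear_scale)
      fix X assume X: "X \<in> V" "\<forall>H\<in>t_alg. killing_form g_alg H X = 0"
      have "Im (X $ Inl k $ Inl k) = 0" for k
        using X V(3) n t_basis_in_t_alg[of k] killing_form_t_basis[of X k] by auto
      then show "restrict (diag_pairing \<xi>) V X = 0" using X(1) by (simp add: diag_pairing_def)
    qed (use t in simp)
  next
    fix F assume F: "F \<in> dual_space V \<and> (\<forall>k. F (t_basis k) = \<xi> $ k) \<and>
      (\<forall>X\<in>V. (\<forall>H\<in>t_alg. killing_form g_alg H X = 0) \<longrightarrow> F X = 0)"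
    show "F = restrict (diag_pairing \<xi>) V"
    proof (rule extensionalityI[where A=V])
      show "F \<in> extensional V" using F by (simp add: dual_space_def)
      fix X assume X: "X \<in> V"
      define c where "c k = Im (X $ Inl k $ Inl k)" for k
      have "t_elem c \<in> V" using V(2) by auto
      with V(1) X have HV: "t_elem c \<in> V" "X - t_elem c \<in> V" by (auto intro: subspace_diff)
      have "killing_form g_alg H (X - t_elem c) = 0" if "H \<in> t_alg" for H
        using that HV V(3) by (auto simp: t_alg_eq_range killing_form_t_elem c_def)
      then have "F (X - t_elem c) = 0" using F HV by blast
      moreover have "F (t_elem c + (X - t_elem c)) = F (t_elem c) + F (X - t_elem c)"
        using F HV unfolding dual_space_def by blast
      \<comment> \<open>Linearity of \<open>F\<close> is known only on \<open>V\<close> and for two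
        summands, hence an induction over the index set.\<close>
      moreover have "F (\<Sum>k\<in>I. c k *\<^sub>R t_basis k) = (\<Sum>k\<in>I. c k * \<xi> $ k)" if "finite I" for I
        using that
      proof (induction I rule: finite_induct)
        case empty
        have "F (0 *\<^sub>R X) = 0 * F X" using F X unfolding dual_space_def by blast
        then show ?case by simp
      next
        case (insert k I)
        have 1: "c k *\<^sub>R t_basis k \<in> V" "(\<Sum>k\<in>I. c k *\<^sub>R t_basis k) \<in> V"
          using t V by (auto intro!: subspace_scale subspace_sum)
        have "F (c k *\<^sub>R t_basis k + (\<Sum>k\<in>I. c k *\<^sub>R t_basis k)) =
            F (c k *\<^sub>R t_basis k) + F (\<Sum>k\<in>I. c k *\<^sub>R t_basis k)"
          using F 1 unfolding dual_space_def by blast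
        moreover have "F (c k *\<^sub>R t_basis k) = c k * F (t_basis k)"
          using F t unfolding dual_space_def by blast
        ultimately show ?case using insert F by simp
      qed
      ultimately have "F X = (\<Sum>k\<in>UNIV. c k * \<xi> $ k)"
        by (simp add: t_elem_def)
      then show "F X = restrict (diag_pairing \<xi>) V X"
        using X by (simp add: diag_pairing_def c_def mult.commute)
    qed simp
  qed
qed

lemma killing_vector_eq:
  fixes \<xi> :: "real ^ 'n::finite"
  assumes n: "CARD('n) \<ge> 2"
  shows "killing_vector \<xi> = t_elem (\<lambda>k. - \<xi> $ k / (4 * real CARD('n) - 4))"
  unfolding killing_vector_def
proof (rule the_equality)
  have tg: "t_basis k \<in> g_alg" for k :: 'n
    using t_basis_in_t_alg t_alg_subset_g_alg by blast
  have kt: "killing_form g_alg (t_elem c) (t_basis k) = - (4 * real CARD('n) - 4) * c k" for c and k :: 'n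
  proof -
    have "(\<Sum>l\<in>UNIV. c l * Im (t_basis k $ Inl l $ Inl l)) = (\<Sum>l\<in>UNIV. if k = l then c l else 0)"
      by (intro sum.cong) auto
    then show ?thesis
      by (simp add: killing_form_t_elem[OF tg])
  qed
  have n': "4 * real CARD('n) - 4 \<noteq> 0" using n by simp
  show "t_elem (\<lambda>k. - \<xi> $ k / (4 * real CARD('n) - 4)) \<in> t_alg \<and>
    (\<forall>k. killing_form g_alg (t_elem (\<lambda>k. - \<xi> $ k / (4 * real CARD('n) - 4))) (t_basis k) = \<xi> $ k)"
    unfolding kt using n' by (simp del: minus_diff_eq)
  fix H assume H: "H \<in> t_alg \<and> (\<forall>k. killing_form g_alg H (t_basis k) = \<xi> $ k)"
  then obtain c where c: "H = t_elem c" by (auto simp: t_alg_eq_range)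
  with H have "- (4 * real CARD('n) - 4) * c k = \<xi> $ k" for k
    using kt by metis
  then have "c k = - \<xi> $ k / (4 * real CARD('n) - 4)" for k
    using n by (simp add: field_simps)
  then have "c = (\<lambda>k. - \<xi> $ k / (4 * real CARD('n) - 4))" by blast
  then show "H = t_elem (\<lambda>k. - \<xi> $ k / (4 * real CARD('n) - 4))" by (simp add: c)
qed

text \<open>A positive multiple of the standard scalar product, so membership in
  \<open>C_hol\<close> turns into positivity of the sums
  \<open>\<Lambda> $ i + \<Lambda> $ j\<close>.\<close>

lemma killing_inner_eq:
  fixes \<xi> \<eta> :: "real ^ 'n::finite"
  assumes n: "CARD('n) \<ge> 2"
  shows "killing_inner \<xi> \<eta> = (\<Sum>k\<in>UNIV. \<xi> $ k * \<eta> $ k) / (4 * real CARD('n) - 4)"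
proof -
  define N where "N = 4 * real CARD('n) - 4"
  have N: "N > 0" using n by (simp add: N_def)
  have "t_elem c \<in> g_alg" for c :: "'n \<Rightarrow> real"
    using t_alg_subset_g_alg by auto
  then have "killing_inner \<xi> \<eta> = N * (\<Sum>k\<in>UNIV. (\<xi> $ k / N) * (\<eta> $ k / N))"
    by (simp add: killing_inner_def killing_vector_eq[OF n] killing_form_t_elem N_def[symmetric])
  also have "\<dots> = (\<Sum>k\<in>UNIV. \<xi> $ k * \<eta> $ k / N)"
    unfolding sum_distrib_left using N by (intro sum.cong) (auto simp: field_simps)
  finally show ?thesis by (simp add: N_def sum_divide_distrib)
qed

lemma C_hol_pos:
  assumes "\<Lambda> \<in> C_hol" "i \<noteq> j"
  shows "\<Lambda> $ i + \<Lambda> $ j > 0"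
proof -
  have "(axis i 1 + axis j 1 :: real ^ 3) \<in> pos_noncompact_roots"
    using assms(2) by (auto simp: pos_noncompact_roots_def)
  then have "killing_inner \<Lambda> (axis i 1 + axis j 1) > 0"
    using assms(1) by (auto simp: C_hol_def)
  moreover have "(\<Sum>k\<in>UNIV. \<Lambda> $ k * (axis i 1 + axis j 1 :: real ^ 3) $ k) = \<Lambda> $ i + \<Lambda> $ j"
    by (simp add: axis_def algebra_simps sum.distrib if_distrib[of "(*) _"] cong: if_cong)
  ultimately show ?thesis
    by (simp add: killing_inner_eq)
qed

subsection \<open>The projection of an orbit\<close>

text \<open>Each of the two invariant forms gives an expression for the inverse; that the two agree
  ties the lower blocks to the upper ones in \<open>SO_star_blockE\<close>.\<close>

lemma SO_star_matrix_inv: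
  assumes "M \<in> SO_star"
  shows "matrix_inv M = J_mat ** hermitian_adjoint M ** J_mat"
    and "matrix_inv M = S_mat ** transpose M ** S_mat"
    and "matrix_inv M ** M = mat 1" and "M ** matrix_inv M = mat 1"
proof -
  have JJ: "J_mat ** J_mat = (mat 1 :: ('a + 'a) cmat)" and SS: "S_mat ** S_mat = (mat 1 :: ('a + 'a) cmat)"
    by (simp_all add: mat_block[symmetric] mm_simps)
  have "J_mat ** hermitian_adjoint M ** J_mat ** M = J_mat ** (hermitian_adjoint M ** J_mat ** M)"
    by (simp only: matrix_mul_assoc)
  then have 1: "J_mat ** hermitian_adjoint M ** J_mat ** M = mat 1"
    using assms by (simp only: SO_star_def SU_nn_def mem_Collect_eq JJ)
  have "S_mat ** transpose M ** S_mat ** M = S_mat ** (transpose M ** S_mat ** M)"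
    by (simp only: matrix_mul_assoc)
  then have 2: "S_mat ** transpose M ** S_mat ** M = mat 1"
    using assms by (simp only: SO_star_def mem_Collect_eq SS)
  show 3: "matrix_inv M = J_mat ** hermitian_adjoint M ** J_mat"
    using 1 matrix_left_right_inverse matrix_inv_eqI by blast
  show "matrix_inv M = S_mat ** transpose M ** S_mat"
    using 2 matrix_left_right_inverse matrix_inv_eqI by blast
  show 4: "matrix_inv M ** M = mat 1" unfolding 3 by (rule 1)
  show "M ** matrix_inv M = mat 1" using 4 matrix_left_right_inverse by blast
qed

text \<open>The first two relations are blocks of \<open>M ** matrix_inv M\<close>. The third is a
  block of \<open>matrix_inv M ** M\<close> and will yield the invertibility of
  \<open>a\<close>.\<close>

lemma SO_star_blockE:
  assumes M: "M \<in> SO_star"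
  obtains a b where "M = block a b (- conj_mat b) (conj_mat a)"
    "matrix_inv M = block (hermitian_adjoint a) (transpose b) (- hermitian_adjoint b) (transpose a)"
    "a ** hermitian_adjoint a - b ** hermitian_adjoint b = mat 1"
    "a ** transpose b + b ** transpose a = 0"
    "hermitian_adjoint a ** a - transpose b ** conj_mat b = mat 1"
proof -
  obtain a b c d where block: "M = block a b c d" by (rule block_exhaust)
  have "J_mat ** hermitian_adjoint M ** J_mat = S_mat ** transpose M ** S_mat"
    using SO_star_matrix_inv(1,2)[OF M] by simp
  then have "hermitian_adjoint a = transpose d" "- hermitian_adjoint c = transpose b"
    by (simp_all add: block mm_simps)
  then have "conj_mat (hermitian_adjoint a) = conj_mat (transpose d)"
    "conj_mat (- hermitian_adjoint c) = conj_mat (transpose b)" by simp_all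
  then have "transpose (transpose a) = transpose (hermitian_adjoint d)"
    "transpose (- transpose c) = transpose (hermitian_adjoint b)" by simp_all
  then have d: "d = conj_mat a" and c: "c = - conj_mat b"
    by (simp_all add: minus_equation_iff[of c])
  note Mab = block[unfolded c d]
  have inv: "matrix_inv M = block (hermitian_adjoint a) (transpose b) (- hermitian_adjoint b) (transpose a)"
    unfolding SO_star_matrix_inv(1)[OF M] by (simp add: Mab mm_simps)
  have "a ** hermitian_adjoint a - b ** hermitian_adjoint b = mat 1" "a ** transpose b + b ** transpose a = 0"
    using SO_star_matrix_inv(4)[OF M] unfolding inv by (simp_all add: Mab mm_simps mat_block)
  moreover have "hermitian_adjoint a ** a - transpose b ** conj_mat b = mat 1"
    using SO_star_matrix_inv(3)[OF M] unfolding inv by (simp_all add: Mab mm_simps mat_block)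
  ultimately show thesis using that Mab inv by blast
qed

text \<open>The functionals are \<open>undefined\<close> off \<open>g_alg\<close>, so evaluating the
  coadjoint action requires that conjugation preserve \<open>g_alg\<close>.\<close>

lemma SO_star_conj_g_alg:
  assumes "M \<in> SO_star" and "X \<in> g_alg"
  shows "matrix_inv M ** X ** M \<in> g_alg"
proof -
  have X: "hermitian_adjoint X ** J_mat + J_mat ** X = 0" "transpose X ** S_mat + S_mat ** X = 0"
    using assms(2) unfolding g_alg_eq by simp_all
  have M: "hermitian_adjoint M ** J_mat ** M = J_mat" "transpose M ** S_mat ** M = S_mat"
    using assms(1) unfolding SO_star_def SU_nn_def by simp_all
  have *: "t (matrix_inv M ** X ** M) ** Q + Q ** (matrix_inv M ** X ** M) = 0"
    if X: "t X ** Q + Q ** X = 0" and M': "t M ** Q ** M = Q" and inv: "Q ** matrix_inv M = t M ** Q"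
      "t (matrix_inv M) ** Q = Q ** M"
      and t: "\<And>A B. t (A ** B) = t B ** t A" for t :: "('a + 'a) cmat \<Rightarrow> _" and Q
  proof -
    have "t (matrix_inv M ** X ** M) ** Q = t M ** t X ** (t (matrix_inv M) ** Q)"
      by (simp only: t matrix_mul_assoc)
    also have "\<dots> = t M ** (t X ** Q) ** M"
      by (simp only: inv(2) matrix_mul_assoc)
    finally have "t (matrix_inv M ** X ** M) ** Q + Q ** (matrix_inv M ** X ** M) =
        t M ** (t X ** Q) ** M + t M ** (Q ** X) ** M"
      by (simp only: inv(1) matrix_mul_assoc)
    also have "\<dots> = t M ** (t X ** Q + Q ** X) ** M"
      by (simp only: mm.add_left mm.add_right)
    finally show ?thesis by (simp add: X)
  qed
  have JJ: "J_mat ** J_mat = (mat 1 :: ('a + 'a) cmat)" and SS: "S_mat ** S_mat = (mat 1 :: ('a + 'a) cmat)"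
    by (simp_all add: mat_block[symmetric] mm_simps)
  have JJZ: "J_mat ** (J_mat ** Z) = Z" and SSZ: "S_mat ** (S_mat ** Z) = Z" for Z :: "('a + 'a) cmat"
    by (simp_all only: matrix_mul_assoc JJ SS matrix_mul_lid)
  have J: "hermitian_adjoint J_mat = (J_mat :: ('a + 'a) cmat)" and S: "transpose S_mat = (S_mat :: ('a + 'a) cmat)"
    by simp_all
  have "hermitian_adjoint (matrix_inv M ** X ** M) ** J_mat + J_mat ** (matrix_inv M ** X ** M) = 0"
  proof (rule *[OF X(1) M(1)])
    show "J_mat ** matrix_inv M = hermitian_adjoint M ** J_mat"
      "hermitian_adjoint (matrix_inv M) ** J_mat = J_mat ** M"
      by (simp_all only: SO_star_matrix_inv(1)[OF assms(1)] hermitian_adjoint_simps J matrix_mul_assoc[symmetric] JJZ JJ matrix_mul_rid)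
  qed simp_all
  moreover have "transpose (matrix_inv M ** X ** M) ** S_mat + S_mat ** (matrix_inv M ** X ** M) = 0"
  proof (rule *[OF X(2) M(2)])
    show "S_mat ** matrix_inv M = transpose M ** S_mat"
      "transpose (matrix_inv M) ** S_mat = S_mat ** M"
      by (simp_all only: SO_star_matrix_inv(2)[OF assms(1)] transpose_mult transpose_transpose S matrix_mul_assoc[symmetric] SSZ SS matrix_mul_rid)
  qed simp_all
  ultimately show ?thesis by (simp only: g_alg_eq mem_Collect_eq simp_thms)
qed

text \<open>The trace pairing of hermitian with skew-hermitian matrices is nondegenerate: testing
  against \<open>\<i> P\<close> yields the sum of the squared moduli of the entries.\<close>

lemma hermitian_eq_0I:
  fixes P :: "'n::finite cmat"
  assumes P: "hermitian_adjoint P = P"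
    and 0: "\<And>A. hermitian_adjoint A = - A \<Longrightarrow> Im (trace (P ** A)) = 0"
  shows "P = 0"
proof -
  have sym: "P $ j $ i = cnj (P $ i $ j)" for i j
    using arg_cong[OF P, of "\<lambda>M. M $ j $ i"] by simp
  define A where "A = mat \<i> ** P"
  have "hermitian_adjoint A $ i $ j = (- A) $ i $ j" for i j
    unfolding A_def hermitian_adjoint_nth by (simp add: sym[of i j])
  then have "hermitian_adjoint A = - A" by (simp add: vec_eq_iff)
  then have "Im (trace (P ** A)) = 0" by (rule 0)
  also have "trace (P ** A) = (\<Sum>i\<in>UNIV. \<Sum>j\<in>UNIV. \<i> * of_real ((cmod (P $ i $ j))\<^sup>2))"
    unfolding trace_def matrix_mult_nth[of P] A_def mat_mult_nth
  proof (intro sum.cong refl)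
    fix i j
    show "P $ i $ j * (\<i> * P $ j $ i) = \<i> * of_real ((cmod (P $ i $ j))\<^sup>2)"
      using sym[of i j] by (simp add: complex_norm_square mult_ac del: of_real_power)
  qed
  finally have "(\<Sum>i\<in>UNIV. \<Sum>j\<in>UNIV. (cmod (P $ i $ j))\<^sup>2) = 0" by simp
  then have "\<forall>i j. (cmod (P $ i $ j))\<^sup>2 = 0"
    by (simp add: sum_nonneg_eq_0_iff sum_nonneg)
  then show ?thesis by (simp add: vec_eq_iff)
qed

lemma kirwan_polyhedron_eq:
  "kirwan_polyhedron (coadjoint_orbit \<Lambda>) = {\<xi> \<in> t_dual_plus. \<exists>a b.
     block a b (- conj_mat b) (conj_mat a) \<in> SO_star \<and>
     a ** diag_mat \<Lambda> ** hermitian_adjoint a + b ** diag_mat \<Lambda> ** hermitian_adjoint b = diag_mat \<xi>}"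
proof -
  let ?N = "\<lambda>a b. a ** diag_mat \<Lambda> ** hermitian_adjoint a + b ** diag_mat \<Lambda> ** hermitian_adjoint b"
  have kg: "k_alg \<subseteq> (g_alg :: (3 + 3) cmat set)" by (rule k_alg_subset_g_alg)
  have tk: "t_alg \<subseteq> (k_alg :: (3 + 3) cmat set)" by (rule t_alg_subset_k_alg)
  have embk: "killing_embed k_alg \<xi> = restrict (diag_pairing \<xi>) k_alg" for \<xi> :: "real ^ 3"
    by (rule killing_embed_eq) (simp_all add: subspace_k_alg kg tk)
  have embg: "killing_embed g_alg \<xi> = restrict (diag_pairing \<xi>) g_alg" for \<xi> :: "real ^ 3"
    by (rule killing_embed_eq) (use subspace_g_alg kg tk in auto)
  have key: "killing_embed k_alg \<xi> = restrict (coadjoint M (killing_embed g_alg \<Lambda>)) k_alg \<longleftrightarrow>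
      ?N a b = diag_mat \<xi>"
    if M: "M \<in> SO_star" and Mab: "M = block a b (- conj_mat b) (conj_mat a)"
      and inv: "matrix_inv M = block (hermitian_adjoint a) (transpose b) (- hermitian_adjoint b) (transpose a)"
    for M a b \<xi>
  proof -
    have Ad: "matrix_inv M ** X ** M \<in> g_alg" if "X \<in> g_alg" for X
      using SO_star_conj_g_alg M that by blast
    have pair: "diag_pairing \<Lambda> (matrix_inv M ** block A 0 0 (conj_mat A) ** M) = Im (trace (?N a b ** A))" for A
    proof -
      let ?D = "diag_mat \<Lambda>"
      have "matrix_inv M ** block A 0 0 (conj_mat A) ** M = block (hermitian_adjoint a ** A ** a -
          transpose b ** conj_mat A ** conj_mat b) (hermitian_adjoint a ** A ** b + transpose b ** conj_mat A ** conj_mat a)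
          (- hermitian_adjoint b ** A ** a - transpose a ** conj_mat A ** conj_mat b)
          (- hermitian_adjoint b ** A ** b + transpose a ** conj_mat A ** conj_mat a)"
        unfolding inv unfolding Mab by (simp add: mm_simps)
      moreover have "trace (?D ** (hermitian_adjoint a ** A ** a)) = trace (a ** ?D ** hermitian_adjoint a ** A)"
        using trace_mul_sym[of "?D ** hermitian_adjoint a ** A" a] by (simp add: matrix_mul_assoc)
      \<comment> \<open>The lower block enters as minus a complex conjugate, so its imaginary part
        is added; this is why \<open>N\<close> has a plus sign although the group relation has a
        minus sign.\<close>
      moreover have "trace (?D ** (transpose b ** conj_mat A ** conj_mat b)) =
          cnj (trace (b ** ?D ** hermitian_adjoint b ** A))"
        using trace_mul_sym[of "?D ** transpose b ** conj_mat A" "conj_mat b"]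
        by (simp add: matrix_mul_assoc flip: trace_conj_mat)
      ultimately show ?thesis
        by (simp add: diag_pairing_block mm.diff_right mm.add_left trace_sub trace_add)
    qed
    have "killing_embed k_alg \<xi> = restrict (coadjoint M (killing_embed g_alg \<Lambda>)) k_alg \<longleftrightarrow>
        (\<forall>X\<in>k_alg. diag_pairing \<xi> X = diag_pairing \<Lambda> (matrix_inv M ** X ** M))"
      unfolding embk embg coadjoint_def using kg Ad by (auto simp: restrict_def fun_eq_iff subset_iff)
    also have "\<dots> \<longleftrightarrow> (\<forall>A. hermitian_adjoint A = - A \<longrightarrow> Im (trace (diag_mat \<xi> ** A)) = Im (trace (?N a b ** A)))"
      unfolding k_alg_eq using pair by (auto simp: diag_pairing_block)
    also have "\<dots> \<longleftrightarrow> ?N a b = diag_mat \<xi>"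
    proof
      assume *: "\<forall>A. hermitian_adjoint A = - A \<longrightarrow> Im (trace (diag_mat \<xi> ** A)) = Im (trace (?N a b ** A))"
      have "?N a b - diag_mat \<xi> = 0"
        by (rule hermitian_eq_0I)
           (use * in \<open>auto simp: matrix_mul_assoc mm.diff_left trace_sub\<close>)
      then show "?N a b = diag_mat \<xi>" by simp
    qed simp
    finally show ?thesis .
  qed
  show ?thesis
    unfolding kirwan_polyhedron_def coadjoint_orbit_def
  proof (intro Collect_cong conj_cong refl iffI)
    fix \<xi>
    assume "killing_embed k_alg \<xi> \<in> (\<lambda>F. restrict F k_alg) ` {coadjoint M (killing_embed g_alg \<Lambda>) | M. M \<in> SO_star}"
    then obtain M where M: "M \<in> SO_star"
      "killing_embed k_alg \<xi> = restrict (coadjoint M (killing_embed g_alg \<Lambda>)) k_alg" by blast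
    obtain a b where ab: "M = block a b (- conj_mat b) (conj_mat a)"
      "matrix_inv M = block (hermitian_adjoint a) (transpose b) (- hermitian_adjoint b) (transpose a)"
      using SO_star_blockE[OF M(1)] by metis
    show "\<exists>a b. block a b (- conj_mat b) (conj_mat a) \<in> SO_star \<and> ?N a b = diag_mat \<xi>"
      using M key[OF M(1) ab] ab(1) by blast
  next
    fix \<xi>
    assume "\<exists>a b. block a b (- conj_mat b) (conj_mat a) \<in> SO_star \<and> ?N a b = diag_mat \<xi>"
    then obtain a b where ab: "block a b (- conj_mat b) (conj_mat a) \<in> SO_star" "?N a b = diag_mat \<xi>" by blast
    define M where "M = block a b (- conj_mat b) (conj_mat a)"
    have inv: "matrix_inv M = block (hermitian_adjoint a) (transpose b) (- hermitian_adjoint b) (transpose a)"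
      using SO_star_matrix_inv(1)[OF ab(1)] unfolding M_def by (simp add: mm_simps)
    show "killing_embed k_alg \<xi> \<in> (\<lambda>F. restrict F k_alg) ` {coadjoint M (killing_embed g_alg \<Lambda>) | M. M \<in> SO_star}"
      using key[OF _ M_def inv, of \<xi>] ab M_def by blast
  qed
qed

subsection \<open>Interlacing\<close>

text \<open>Compares the coefficients of \<open>x^2\<close>, isolated by the values at 0, 1 and
  -1.\<close>

lemma rank_one_trace:
  fixes y1 y2 y3 L1 L2 L3 h1 h2 h3 :: real
  assumes "\<And>x. (x - y1) * (x - y2) * (x - y3) = (x - L1) * (x - L2) * (x - L3) +
      h1 * ((x - L2) * (x - L3)) + h2 * ((x - L1) * (x - L3)) + h3 * ((x - L1) * (x - L2))"
  shows "y1 + y2 + y3 = L1 + L2 + L3 - (h1 + h2 + h3)"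
  using assms[of 0] assms[of 1] assms[of "-1"] by (simp add: algebra_simps)

text \<open>The right side is the characteristic polynomial of \<open>diag(L) - v v\<^sup>T\<close>
  with \<open>v_i^2 = h_i\<close>. Its signs at \<open>L2\<close>, at \<open>L3\<close> and beyond
  \<open>L1\<close> locate the roots, except where a root meets coinciding \<open>L2\<close> and
  \<open>L3\<close>; there a common linear factor is cancelled.\<close>

lemma interlacing_of_rank_one:
  fixes y1 y2 y3 L1 L2 L3 h1 h2 h3 :: real
  assumes L: "L2 \<le> L1" "L3 \<le> L2" and y: "y2 \<le> y1" "y3 \<le> y2" and h: "0 \<le> h1" "0 \<le> h2" "0 \<le> h3"
    and eq: "\<And>x. (x - y1) * (x - y2) * (x - y3) = (x - L1) * (x - L2) * (x - L3) +
      h1 * ((x - L2) * (x - L3)) + h2 * ((x - L1) * (x - L3)) + h3 * ((x - L1) * (x - L2))"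
  shows "y1 \<le> L1 \<and> L2 \<le> y1 \<and> y2 \<le> L2 \<and> L3 \<le> y2 \<and> y3 \<le> L3"
proof -
  have F2: "(L2 - y1) * (L2 - y2) * (L2 - y3) \<le> 0"
    unfolding eq using L h by (simp add: mult_nonneg_nonneg mult_nonneg_nonpos mult_nonpos_nonneg)
  have F3: "(L3 - y1) * (L3 - y2) * (L3 - y3) \<ge> 0"
    unfolding eq using L h by (simp add: mult_nonneg_nonneg mult_nonpos_nonpos)
  have s1: "y1 + y2 + y3 = L1 + L2 + L3 - (h1 + h2 + h3)"
    and s2: "y1 * y2 + y1 * y3 + y2 * y3 =
      L1 * L2 + L1 * L3 + L2 * L3 - (h1 * (L2 + L3) + h2 * (L1 + L3) + h3 * (L1 + L2))"
    using eq[of 0] eq[of 1] eq[of "-1"] by (simp_all add: algebra_simps)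
  have 1: "y1 \<le> L1"
  proof (rule ccontr)
    assume "\<not> y1 \<le> L1"
    then have p: "y1 - L1 > 0" "y1 - L2 > 0" "y1 - L3 > 0" using L by auto
    have "(y1 - L1) * (y1 - L2) * (y1 - L3) + h1 * ((y1 - L2) * (y1 - L3)) +
      h2 * ((y1 - L1) * (y1 - L3)) + h3 * ((y1 - L1) * (y1 - L2)) > 0"
      using p h by (intro add_pos_nonneg mult_pos_pos mult_nonneg_nonneg) auto
    then show False using eq[of y1] by simp
  qed
  have 2: "L2 \<le> y1"
  proof (rule ccontr)
    assume "\<not> L2 \<le> y1"
    then have "(L2 - y1) * (L2 - y2) * (L2 - y3) > 0" using y by (intro mult_pos_pos) auto
    then show False using F2 by simp
  qed
  have 3: "y3 \<le> L3"
  proof (rule ccontr)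
    assume "\<not> y3 \<le> L3"
    then have "(y1 - L3) * (y2 - L3) * (y3 - L3) > 0" using y by (intro mult_pos_pos) auto
    moreover have "(L3 - y1) * (L3 - y2) * (L3 - y3) = - ((y1 - L3) * (y2 - L3) * (y3 - L3))"
      by algebra
    ultimately show False using F3 by linarith
  qed
  have 4: "y2 \<le> L2"
  proof (rule ccontr)
    assume *: "\<not> y2 \<le> L2"
    then have "(y1 - L2) * (y2 - L2) > 0" using y by (intro mult_pos_pos) auto
    then have "(L2 - y1) * (L2 - y2) > 0" by (simp add: algebra_simps)
    with F2 have "L2 \<le> y3"
      using mult_pos_pos[of "(L2 - y1) * (L2 - y2)" "L2 - y3"] by fastforce
    with 3 L have eqs: "y3 = L2" "L3 = L2" by auto
    \<comment> \<open>The value at \<open>L2\<close> of the identity after division by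
      \<open>x - L2\<close>, obtained from the coefficients; the same device serves for
      \<open>L3 \<le> y2\<close>.\<close>
    have "(L2 - y1) * (L2 - y2) = (h2 + h3) * (L2 - L1)"
      using s1 s2 unfolding eqs by algebra
    also have "\<dots> \<le> 0" using h L by (intro mult_nonneg_nonpos) auto
    finally show False using \<open>(L2 - y1) * (L2 - y2) > 0\<close> by simp
  qed
  have 5: "L3 \<le> y2"
  proof (rule ccontr)
    assume *: "\<not> L3 \<le> y2"
    then have pos: "(L3 - y2) * (L3 - y3) > 0" using y by (intro mult_pos_pos) auto
    have "(L3 - y1) * ((L3 - y2) * (L3 - y3)) \<ge> 0" using F3 by (simp add: mult.assoc)
    with pos have "y1 \<le> L3" by (simp add: zero_le_mult_iff)
    with 2 L have eqs: "y1 = L2" "L3 = L2" by auto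
    have "(L2 - y2) * (L2 - y3) = (h2 + h3) * (L2 - L1)"
      using s1 s2 unfolding eqs by algebra
    also have "\<dots> \<le> 0" using h L by (intro mult_nonneg_nonpos) auto
    finally show False using pos eqs by simp
  qed
  show ?thesis using 1 2 3 4 5 by blast
qed

text \<open>Partial fractions: evaluating at \<open>L_i\<close> forces \<open>h_i\<close> to be the
  product of the \<open>L_i - y_j\<close> over that of the \<open>L_i - L_j\<close>, and interlacing
  makes it nonnegative. When some \<open>L_i\<close> coincide, a root is forced to equal them, a
  common factor cancels and one weight may be 0.\<close>

lemma rank_one_of_interlacing:
  fixes y1 y2 y3 L1 L2 L3 :: real
  assumes "y1 \<le> L1" "L2 \<le> y1" "y2 \<le> L2" "L3 \<le> y2" "y3 \<le> L3"
  shows "\<exists>h1 h2 h3. 0 \<le> h1 \<and> 0 \<le> h2 \<and> 0 \<le> h3 \<and>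
    (\<forall>x. (x - y1) * (x - y2) * (x - y3) = (x - L1) * (x - L2) * (x - L3) +
      h1 * ((x - L2) * (x - L3)) + h2 * ((x - L1) * (x - L3)) + h3 * ((x - L1) * (x - L2)))"
proof -
  consider "L1 = L2" "L2 = L3" | "L1 = L2" "L3 < L2" | "L2 < L1" "L2 = L3" | "L2 < L1" "L3 < L2"
    using assms by linarith
  then show ?thesis
  proof cases
    case 1
    then have "y1 = L1" "y2 = L1" using assms by auto
    with 1 assms show ?thesis
      by (intro exI[of _ "L1 - y3"] exI[of _ 0]) (auto simp: algebra_simps)
  next
    case 2
    then have y1: "y1 = L2" using assms by auto
    define d where "d = L2 - L3"
    have d: "d > 0" using 2 by (simp add: d_def)
    define h2 h3 where "h2 = (L2 - y2) * (L2 - y3) / d" and "h3 = (y2 - L3) * (L3 - y3) / d"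
    have "0 \<le> h2" "0 \<le> h3" using assms d by (auto simp: h2_def h3_def)
    moreover have "(x - L2) * (x - y2) * (x - y3) = (x - L2) * (x - L2) * (x - L3) +
        h2 * ((x - L2) * (x - L3)) + h3 * ((x - L2) * (x - L2))" for x
    proof -
      have "d * ((x - L2) * (x - y2) * (x - y3)) = d * ((x - L2) * (x - L2) * (x - L3)) +
        (d * h2) * ((x - L2) * (x - L3)) + (d * h3) * ((x - L2) * (x - L2))"
        using d unfolding h2_def h3_def by (simp, simp only: d_def, algebra)
      then have "d * ((x - L2) * (x - y2) * (x - y3)) = d * ((x - L2) * (x - L2) * (x - L3) +
        h2 * ((x - L2) * (x - L3)) + h3 * ((x - L2) * (x - L2)))" by (simp add: algebra_simps)
      then show ?thesis using d by (simp only: mult_cancel_left) auto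
    qed
    ultimately show ?thesis
      unfolding 2(1) y1 by (intro exI[of _ 0] exI[of _ h2] exI[of _ h3]) simp
  next
    case 3
    then have y2: "y2 = L3" using assms by auto
    define d where "d = L1 - L3"
    have d: "d > 0" using 3 by (simp add: d_def)
    define h1 h3 where "h1 = (L1 - y1) * (L1 - y3) / d" and "h3 = (y1 - L3) * (L3 - y3) / d"
    have "0 \<le> h1" "0 \<le> h3" using assms 3 d by (auto simp: h1_def h3_def)
    moreover have "(x - y1) * (x - L3) * (x - y3) = (x - L1) * (x - L3) * (x - L3) +
        h1 * ((x - L3) * (x - L3)) + h3 * ((x - L1) * (x - L3))" for x
    proof -
      have "d * ((x - y1) * (x - L3) * (x - y3)) = d * ((x - L1) * (x - L3) * (x - L3)) +
        (d * h1) * ((x - L3) * (x - L3)) + (d * h3) * ((x - L1) * (x - L3))"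
        using d unfolding h1_def h3_def by (simp, simp only: d_def, algebra)
      then have "d * ((x - y1) * (x - L3) * (x - y3)) = d * ((x - L1) * (x - L3) * (x - L3) +
        h1 * ((x - L3) * (x - L3)) + h3 * ((x - L1) * (x - L3)))" by (simp add: algebra_simps)
      then show ?thesis using d by (simp only: mult_cancel_left) auto
    qed
    ultimately show ?thesis
      unfolding 3(2) y2 by (intro exI[of _ h1] exI[of _ 0] exI[of _ h3]) simp
  next
    case 4
    define d12 d13 d23 where "d12 = L1 - L2" and "d13 = L1 - L3" and "d23 = L2 - L3"
    have d: "d12 > 0" "d13 > 0" "d23 > 0" using 4 by (auto simp: d12_def d13_def d23_def)
    \<comment> \<open>The signs are distributed so that every factor is nonnegative.\<close>
    define h1 h2 h3 where "h1 = (L1 - y1) * (L1 - y2) * (L1 - y3) / (d12 * d13)"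
      and "h2 = (y1 - L2) * (L2 - y2) * (L2 - y3) / (d12 * d23)"
      and "h3 = (y1 - L3) * (y2 - L3) * (L3 - y3) / (d13 * d23)"
    have "0 \<le> h1" "0 \<le> h2" "0 \<le> h3" using assms 4 d by (auto simp: h1_def h2_def h3_def)
    moreover have "(x - y1) * (x - y2) * (x - y3) = (x - L1) * (x - L2) * (x - L3) +
      h1 * ((x - L2) * (x - L3)) + h2 * ((x - L1) * (x - L3)) + h3 * ((x - L1) * (x - L2))" for x
    proof -
      define e where "e = d12 * d13 * d23"
      have e: "e > 0" using d by (simp add: e_def)
      have eh: "e * h1 = (L1 - y1) * (L1 - y2) * (L1 - y3) * d23"
        "e * h2 = (y1 - L2) * (L2 - y2) * (L2 - y3) * d13"
        "e * h3 = (y1 - L3) * (y2 - L3) * (L3 - y3) * d12"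
        using d by (simp_all add: e_def h1_def h2_def h3_def)
      have "e * ((x - y1) * (x - y2) * (x - y3)) = e * ((x - L1) * (x - L2) * (x - L3)) +
        (e * h1) * ((x - L2) * (x - L3)) + (e * h2) * ((x - L1) * (x - L3)) + (e * h3) * ((x - L1) * (x - L2))"
        unfolding eh unfolding e_def d12_def d13_def d23_def by algebra
      then have "e * ((x - y1) * (x - y2) * (x - y3)) = e * ((x - L1) * (x - L2) * (x - L3) +
        h1 * ((x - L2) * (x - L3)) + h2 * ((x - L1) * (x - L3)) + h3 * ((x - L1) * (x - L2)))"
        by (simp add: algebra_simps)
      then show ?thesis using e by (simp only: mult_cancel_left) auto
    qed
    ultimately show ?thesis by blast
  qed
qed

text \<open>Interlacing with all weights 0, used in both directions.\<close>

lemma sorted_roots_unique: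
  fixes x1 x2 x3 y1 y2 y3 :: real
  assumes "x2 \<le> x1" "x3 \<le> x2" "y2 \<le> y1" "y3 \<le> y2"
    and eq: "\<And>x. (x - x1) * (x - x2) * (x - x3) = (x - y1) * (x - y2) * (x - y3)"
  shows "x1 = y1 \<and> x2 = y2 \<and> x3 = y3"
proof -
  have "x1 \<le> y1 \<and> y2 \<le> x1 \<and> x2 \<le> y2 \<and> y3 \<le> x2 \<and> x3 \<le> y3"
    by (rule interlacing_of_rank_one[of y2 y1 y3 x2 x1 x3 0 0 0]) (use assms in auto)
  moreover have "y1 \<le> x1 \<and> x2 \<le> y1 \<and> y2 \<le> x2 \<and> x3 \<le> y2 \<and> y3 \<le> x3"
    by (rule interlacing_of_rank_one[of x2 x1 x3 y2 y1 y3 0 0 0]) (use assms in auto)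
  ultimately show ?thesis by auto
qed

subsection \<open>Diagonalisation of real symmetric matrices\<close>

text \<open>A maximum point of the quadratic form on the unit sphere of \<open>S\<close> is
  critical: the residual \<open>u\<close> is orthogonal to \<open>v\<close>, and a small step along
  a nonzero \<open>u\<close> would increase the quotient. The maximality clause serves to order the
  eigenvalues.\<close>

lemma self_adjoint_max_eigenvector:
  fixes f :: "'a::euclidean_space \<Rightarrow> 'a"
  assumes f: "linear f" "\<And>x y. f x \<bullet> y = x \<bullet> f y"
    and S: "subspace S" "\<And>x. x \<in> S \<Longrightarrow> f x \<in> S" and ne: "x0 \<in> S" "x0 \<noteq> 0"
  obtains v where "v \<in> S" "norm v = 1" "f v = (f v \<bullet> v) *\<^sub>R v"
    "\<And>w. w \<in> S \<Longrightarrow> norm w = 1 \<Longrightarrow> f w \<bullet> w \<le> f v \<bullet> v"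
proof -
  have "compact (S \<inter> sphere 0 1)"
    using closed_subspace[OF S(1)] by (intro closed_Int_compact compact_sphere)
  moreover have "x0 /\<^sub>R norm x0 \<in> S \<inter> sphere 0 1"
    using ne S(1) by (simp add: subspace_scale)
  moreover have "continuous_on (S \<inter> sphere 0 1) (\<lambda>w. f w \<bullet> w)"
    using linear_continuous_on[OF f(1)[unfolded linear_conv_bounded_linear]]
    by (intro continuous_intros) auto
  ultimately obtain v where v: "v \<in> S \<inter> sphere 0 1" "\<And>w. w \<in> S \<inter> sphere 0 1 \<Longrightarrow> f w \<bullet> w \<le> f v \<bullet> v"
    using continuous_attains_sup[of "S \<inter> sphere 0 1" "\<lambda>w. f w \<bullet> w"] by blast
  define l where "l = f v \<bullet> v"
  have max: "f w \<bullet> w \<le> l * (w \<bullet> w)" if "w \<in> S" for w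
  proof (cases "w = 0")
    case False
    then have "w /\<^sub>R norm w \<in> S \<inter> sphere 0 1" using that S(1) by (simp add: subspace_scale)
    from v(2)[OF this] have "(f w \<bullet> w) / (norm w * norm w) \<le> l"
      using f(1) by (simp add: l_def linear_scale divide_inverse mult_ac)
    then show ?thesis
      using False by (simp add: divide_le_eq dot_square_norm power2_eq_square)
  qed (use f(1) in \<open>simp add: linear_0\<close>)
  define u where "u = f v - l *\<^sub>R v"
  have vv: "v \<bullet> v = 1" using v(1) by (simp add: dot_square_norm)
  have uS: "u \<in> S" using v(1) S by (auto simp: u_def intro!: subspace_diff subspace_scale)
  have uv: "u \<bullet> v = 0" by (simp add: u_def inner_diff_left l_def vv)
  have fvu: "f v \<bullet> u = u \<bullet> u"
    using uv by (simp add: u_def inner_diff_left inner_diff_right inner_commute algebra_simps)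
  define C where "C = l * (u \<bullet> u) - f u \<bullet> u"
  have quad: "2 * t * (u \<bullet> u) \<le> t\<^sup>2 * C" for t
  proof -
    have "v + t *\<^sub>R u \<in> S" using v(1) uS S(1) by (simp add: subspace_add subspace_scale)
    from max[OF this] have "l + 2 * t * (u \<bullet> u) + t\<^sup>2 * (f u \<bullet> u) \<le> l * (1 + t\<^sup>2 * (u \<bullet> u))"
      using f(2)[of u v] fvu uv vv
      by (simp add: linear_add[OF f(1)] linear_scale[OF f(1)] inner_add_left inner_add_right
          inner_commute l_def power2_eq_square algebra_simps)
    then show ?thesis by (simp add: C_def algebra_simps)
  qed
  have "u = 0"
  proof (rule ccontr)
    assume "u \<noteq> 0"
    then have a: "u \<bullet> u > 0" by simp
    \<comment> \<open>Small enough that \<open>t * C \<le> u \<bullet> u\<close>, which contradicts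
      \<open>quad\<close>.\<close>
    define t where "t = (u \<bullet> u) / (\<bar>C\<bar> + 1)"
    have t: "t > 0" using a by (simp add: t_def)
    have "t * C \<le> t * (\<bar>C\<bar> + 1)" using t by (intro mult_left_mono) auto
    also have "\<dots> = u \<bullet> u" by (simp add: t_def)
    finally have "t * (t * C) \<le> t * (u \<bullet> u)" using t by simp
    with quad[of t] have "2 * t * (u \<bullet> u) \<le> t * (u \<bullet> u)" by (simp add: power2_eq_square mult.assoc)
    then show False using t a by (simp add: mult.assoc)
  qed
  then have "f v = (f v \<bullet> v) *\<^sub>R v" by (simp add: u_def l_def)
  then show thesis using that v by auto
qed

text \<open>Three successive maximisations on nested invariant orthogonal complements. The
  eigenvectors are the rows of \<open>U\<close>, and the nesting orders the eigenvalues.\<close>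

lemma symmetric_matrix_diagonalisation:
  fixes A :: "real ^ 3 ^ 3"
  assumes A: "transpose A = A"
  obtains U :: "real ^ 3 ^ 3" and l :: "real ^ 3" where "U ** transpose U = mat 1"
    "\<And>i j. (U ** A ** transpose U) $ i $ j = (if i = j then l $ i else 0)"
    "l $ 2 \<le> l $ 1" "l $ 3 \<le> l $ 2"
proof -
  define f where "f = (\<lambda>x. A *v x)"
  have f: "linear f" "\<And>x y. f x \<bullet> y = x \<bullet> f y"
    unfolding f_def by (simp, metis A dot_lmul_matrix transpose_matrix_vector)
  have eigen_orth: "f x \<bullet> v = 0" if "f v = c *\<^sub>R v" "x \<bullet> v = 0" for x v c
    using f(2)[of x v] that by simp
  obtain v1 where v1: "norm v1 = 1" "f v1 = (f v1 \<bullet> v1) *\<^sub>R v1"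
    "\<And>w. norm w = 1 \<Longrightarrow> f w \<bullet> w \<le> f v1 \<bullet> v1"
    using self_adjoint_max_eigenvector[OF f subspace_UNIV, of "axis 1 1"] by (auto simp: axis_eq_0_iff)
  define S2 where "S2 = {x. x \<bullet> v1 = 0}"
  have S2: "subspace S2"
    by (auto simp: S2_def subspace_def inner_add_left)
  have fS2: "f x \<in> S2" if "x \<in> S2" for x
    using that eigen_orth[OF v1(2)] by (simp add: S2_def)
  obtain x2 where "x2 \<noteq> 0" "orthogonal v1 x2"
    using orthogonal_to_vector_exists[of v1] by auto
  then have "x2 \<in> S2" by (simp add: S2_def orthogonal_def inner_commute)
  with \<open>x2 \<noteq> 0\<close> obtain v2 where v2: "v2 \<in> S2" "norm v2 = 1" "f v2 = (f v2 \<bullet> v2) *\<^sub>R v2"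
    "\<And>w. w \<in> S2 \<Longrightarrow> norm w = 1 \<Longrightarrow> f w \<bullet> w \<le> f v2 \<bullet> v2"
    using self_adjoint_max_eigenvector[OF f S2 fS2] by blast
  define S3 where "S3 = {x. x \<bullet> v1 = 0 \<and> x \<bullet> v2 = 0}"
  have S3: "subspace S3"
    by (auto simp: S3_def subspace_def inner_add_left)
  have fS3: "f x \<in> S3" if "x \<in> S3" for x
    using that eigen_orth[OF v1(2)] eigen_orth[OF v2(3)] by (simp add: S3_def)
  \<comment> \<open>Two vectors cannot span the space, so \<open>S3\<close> contains a nonzero
    vector.\<close>
  have "dim {v1, v2} \<le> card {v1, v2}" by (rule dim_le_card') simp
  also have "\<dots> < DIM(real ^ 3)" by (simp add: card_insert_if)
  finally obtain x3 where x3: "x3 \<noteq> 0" "\<And>y. y \<in> span {v1, v2} \<Longrightarrow> orthogonal x3 y"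
    using orthogonal_to_subspace_exists[of "{v1, v2}"] by blast
  then have "x3 \<in> S3" using x3(2)[of v1] x3(2)[of v2] by (simp add: S3_def orthogonal_def span_base)
  with \<open>x3 \<noteq> 0\<close> obtain v3 where v3: "v3 \<in> S3" "norm v3 = 1" "f v3 = (f v3 \<bullet> v3) *\<^sub>R v3"
    using self_adjoint_max_eigenvector[OF f S3 fS3] by blast
  define v where "v i = (if i = 1 then v1 else if i = 2 then v2 else v3)" for i :: 3
  define U where "U = (\<chi> i. v i)"
  define l where "l = (\<chi> i. f (v i) \<bullet> v i)"
  have orth: "v i \<bullet> v j = (if i = j then 1 else 0)" for i j
    using v1(1) v2(1,2) v3(1,2) exhaust_3[of i] exhaust_3[of j]
    by (auto simp: v_def S2_def S3_def dot_square_norm inner_commute)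
  have eig: "f (v i) = l $ i *\<^sub>R v i" for i
    using v1(2) v2(3) v3(3) by (auto simp: v_def l_def)
  have nth: "(U ** B ** transpose U) $ i $ j = v i \<bullet> (B *v v j)" for B :: "real ^ 3 ^ 3" and i j
    by (simp add: U_def matrix_matrix_mult_def transpose_def matrix_vector_mult_def inner_vec_def sum_3 algebra_simps)
  show thesis
  proof
    show "U ** transpose U = mat 1"
      using nth[of "mat 1", unfolded matrix_mul_rid matrix_vector_mul_lid] by (simp add: vec_eq_iff orth mat_def)
    show "(U ** A ** transpose U) $ i $ j = (if i = j then l $ i else 0)" for i j
      using eig[of j] by (simp add: nth f_def[symmetric] orth)
    show "l $ 2 \<le> l $ 1" using v1(3)[OF v2(2)] by (simp add: l_def v_def)
    have "v3 \<in> S2" using v3(1) by (simp add: S2_def S3_def)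
    then show "l $ 3 \<le> l $ 2" using v2(4) v3(2) by (simp add: l_def v_def)
  qed
qed

subsection \<open>The characteristic polynomial of the projection\<close>

text \<open>The matrix of the cross product \<open>w \<mapsto> z \<times> w\<close>.\<close>

definition skew_mat :: "complex \<Rightarrow> complex \<Rightarrow> complex \<Rightarrow> 3 cmat" where
  "skew_mat z1 z2 z3 = vector [vector [0, - z3, z2], vector [z3, 0, - z1], vector [- z2, z1, 0]]"

lemma skew_mat_nth [simp]:
  "skew_mat z1 z2 z3 $ 1 $ 1 = 0" "skew_mat z1 z2 z3 $ 1 $ 2 = - z3" "skew_mat z1 z2 z3 $ 1 $ 3 = z2"
  "skew_mat z1 z2 z3 $ 2 $ 1 = z3" "skew_mat z1 z2 z3 $ 2 $ 2 = 0" "skew_mat z1 z2 z3 $ 2 $ 3 = - z1"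
  "skew_mat z1 z2 z3 $ 3 $ 1 = - z2" "skew_mat z1 z2 z3 $ 3 $ 2 = z1" "skew_mat z1 z2 z3 $ 3 $ 3 = 0"
  by (simp_all add: skew_mat_def)

lemma skew_mat_exhaust:
  fixes Z :: "3 cmat"
  assumes "transpose Z = - Z"
  obtains z1 z2 z3 where "Z = skew_mat z1 z2 z3"
proof
  have *: "Z $ j $ i = - Z $ i $ j" for i j
    using arg_cong[OF assms, of "\<lambda>M. M $ i $ j"] by simp
  have diag: "Z $ i $ i = 0" for i
    using *[of i i] by simp
  show "Z = skew_mat (Z $ 3 $ 2) (Z $ 1 $ 3) (Z $ 2 $ 1)"
    using *[of 1 2] *[of 1 3] *[of 2 3] by (simp add: vec_eq_iff forall_3 diag)
qed

text \<open>For \<open>Z\<close> the cross product with \<open>z\<close>, \<open>Z Z\<^sup>*\<close>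
  is \<open>|z|^2\<close> times the orthogonal projection with kernel spanned by
  \<open>cnj z\<close>, so \<open>1 - Z Z\<^sup>*\<close> has eigenvalues 1 and twice
  \<open>1 - |z|^2\<close>.\<close>

lemma det_one_minus_skew:
  "det (mat 1 - skew_mat z1 z2 z3 ** hermitian_adjoint (skew_mat z1 z2 z3)) =
    (1 - z1 * cnj z1 - z2 * cnj z2 - z3 * cnj z3)^2"
  by (simp add: det_3 matrix_mult_nth sum_3 mat_nth) algebra

text \<open>The computational core, with denominators cleared. On the left stands \<open>s\<close>
  times the determinant in \<open>det_skew_pencil\<close>; on the right, \<open>s^3\<close> times
  the rank one polynomial at \<open>x - R / s\<close> with weights
  \<open>t_i (L_j + L_k) / s\<close>.\<close>

lemma skew_pencil_identity:
  fixes x L1 L2 L3 t1 t2 t3 :: "'a::idom"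
  defines "s \<equiv> 1 - t1 - t2 - t3"
  defines "R \<equiv> t1 * (L2 + L3) + t2 * (L1 + L3) + t3 * (L1 + L2)"
  defines "A1 \<equiv> x - L1 - (x + L2) * t3 - (x + L3) * t2"
  defines "A2 \<equiv> x - L2 - (x + L1) * t3 - (x + L3) * t1"
  defines "A3 \<equiv> x - L3 - (x + L1) * t2 - (x + L2) * t1"
  shows "s * (A1 * A2 * A3 + 2 * ((x + L1) * (x + L2) * (x + L3) * (t1 * t2 * t3))
      - A1 * ((x + L1)^2 * (t2 * t3)) - A2 * ((x + L2)^2 * (t1 * t3)) - A3 * ((x + L3)^2 * (t1 * t2))) =
    (s * (x - L1) - R) * (s * (x - L2) - R) * (s * (x - L3) - R) +
    t1 * (L2 + L3) * ((s * (x - L2) - R) * (s * (x - L3) - R)) +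
    t2 * (L1 + L3) * ((s * (x - L1) - R) * (s * (x - L3) - R)) +
    t3 * (L1 + L2) * ((s * (x - L1) - R) * (s * (x - L2) - R))"
  unfolding assms by algebra

lemma det_skew_pencil:
  fixes L :: "real ^ 3" and x :: real and z1 z2 z3 :: complex
  defines "Z \<equiv> skew_mat z1 z2 z3"
  defines "t1 \<equiv> z1 * cnj z1" and "t2 \<equiv> z2 * cnj z2" and "t3 \<equiv> z3 * cnj z3"
  defines "L1 \<equiv> of_real (L $ 1)" and "L2 \<equiv> of_real (L $ 2)" and "L3 \<equiv> of_real (L $ 3)"
  defines "X \<equiv> of_real x"
  defines "A1 \<equiv> X - L1 - (X + L2) * t3 - (X + L3) * t2"
    and "A2 \<equiv> X - L2 - (X + L1) * t3 - (X + L3) * t1"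
    and "A3 \<equiv> X - L3 - (X + L1) * t2 - (X + L2) * t1"
  shows "det (x *\<^sub>R (mat 1 - Z ** hermitian_adjoint Z) - (diag_mat L + Z ** diag_mat L ** hermitian_adjoint Z)) =
    A1 * A2 * A3 + 2 * ((X + L1) * (X + L2) * (X + L3) * (t1 * t2 * t3))
      - A1 * ((X + L1)^2 * (t2 * t3)) - A2 * ((X + L2)^2 * (t1 * t3)) - A3 * ((X + L3)^2 * (t1 * t2))"
  unfolding det_3
  by (simp add: assms matrix_mult_nth[of _ "hermitian_adjoint _"] sum_3 mat_nth diag_mat_nth scaleR_conv_of_real[where 'a=complex]) algebra

text \<open>\<open>mat x - N = a (x (1 - Z Z\<^sup>*) - (D + Z D Z\<^sup>*)) a\<^sup>*\<close> for \<open>N = a D a\<^sup>* + b D b\<^sup>*\<close>.\<close>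

lemma det_projection:
  fixes L :: "real ^ 3" and x :: real and z1 z2 z3 :: complex
  defines "Z \<equiv> skew_mat z1 z2 z3"
  defines "t1 \<equiv> (cmod z1)\<^sup>2" and "t2 \<equiv> (cmod z2)\<^sup>2" and "t3 \<equiv> (cmod z3)\<^sup>2"
  defines "s \<equiv> 1 - t1 - t2 - t3"
  defines "R \<equiv> t1 * (L $ 2 + L $ 3) + t2 * (L $ 1 + L $ 3) + t3 * (L $ 1 + L $ 2)"
  assumes a: "a ** (mat 1 - Z ** hermitian_adjoint Z) ** hermitian_adjoint a = mat 1" and b: "b = a ** Z"
    and N: "N = a ** diag_mat L ** hermitian_adjoint a + b ** diag_mat L ** hermitian_adjoint b"
  shows "of_real (s ^ 3) * det (x *\<^sub>R mat 1 - N) = of_real (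
    (s * (x - L $ 1) - R) * (s * (x - L $ 2) - R) * (s * (x - L $ 3) - R) +
    t1 * (L $ 2 + L $ 3) * ((s * (x - L $ 2) - R) * (s * (x - L $ 3) - R)) +
    t2 * (L $ 1 + L $ 3) * ((s * (x - L $ 1) - R) * (s * (x - L $ 3) - R)) +
    t3 * (L $ 1 + L $ 2) * ((s * (x - L $ 1) - R) * (s * (x - L $ 2) - R)))" (is "_ = of_real ?P")
proof -
  define W where "W = x *\<^sub>R (mat 1 - Z ** hermitian_adjoint Z) -
    (diag_mat L + Z ** diag_mat L ** hermitian_adjoint Z)"
  have t: "z1 * cnj z1 = of_real t1" "z2 * cnj z2 = of_real t2" "z3 * cnj z3 = of_real t3"
    by (simp_all add: t1_def t2_def t3_def complex_norm_square del: of_real_power)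
  have "a ** W ** hermitian_adjoint a =
      x *\<^sub>R (a ** (mat 1 - Z ** hermitian_adjoint Z) ** hermitian_adjoint a) - N"
    by (simp add: W_def N b mm_simps scaleR_diff_right)
  then have "det (x *\<^sub>R mat 1 - N) = det a * det W * det (hermitian_adjoint a)"
    unfolding a by (metis det_mul)
  \<comment> \<open>Determinants in hypothesis \<open>a\<close>; the factor \<open>s^2\<close> comes
    from \<open>det_one_minus_skew\<close>, so \<open>s^3 det (x - N)\<close> reduces to
    \<open>s det W\<close>.\<close>
  moreover have "det a * (of_real s)\<^sup>2 * det (hermitian_adjoint a) = 1"
    using arg_cong[OF a, of det] unfolding det_mul Z_def det_one_minus_skew t by (simp add: s_def)
  ultimately have "of_real (s ^ 3) * det (x *\<^sub>R mat 1 - N) = of_real s * det W"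
    by simp algebra
  also have "\<dots> = of_real ?P"
    unfolding W_def Z_def det_skew_pencil t
    using skew_pencil_identity[of "of_real t1 :: complex" "of_real t2" "of_real t3" "of_real x"
        "of_real (L $ 1)" "of_real (L $ 2)" "of_real (L $ 3)"]
    by (simp add: s_def R_def)
  finally show ?thesis .
qed

lemma det_diag:
  fixes \<xi> :: "real ^ 3"
  shows "det (x *\<^sub>R mat 1 - diag_mat \<xi>) = of_real ((x - \<xi> $ 1) * (x - \<xi> $ 2) * (x - \<xi> $ 3))"
  by (simp add: det_3 mat_nth diag_mat_nth scaleR_conv_of_real[where 'a=complex])

text \<open>The matrix \<open>1 - Z Z\<^sup>*\<close> is a Gram matrix \<open>e e\<^sup>*\<close>
  with nonzero determinant, so its eigenvalue \<open>1 - |z|^2\<close> is nonnegative and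
  nonzero.\<close>

lemma skew_norm_less_one:
  fixes a :: "3 cmat" and z1 z2 z3 :: complex
  defines "Z \<equiv> skew_mat z1 z2 z3"
  assumes a: "a ** (mat 1 - Z ** hermitian_adjoint Z) ** hermitian_adjoint a = mat 1"
  shows "(cmod z1)\<^sup>2 + (cmod z2)\<^sup>2 + (cmod z3)\<^sup>2 < 1"
proof -
  define t1 t2 t3 where "t1 = (cmod z1)\<^sup>2" and "t2 = (cmod z2)\<^sup>2" and "t3 = (cmod z3)\<^sup>2"
  have t: "z1 * cnj z1 = of_real t1" "z2 * cnj z2 = of_real t2" "z3 * cnj z3 = of_real t3"
    by (simp_all add: t1_def t2_def t3_def complex_norm_square del: of_real_power)
  define W where "W = mat 1 - Z ** hermitian_adjoint Z"
  define e where "e = W ** hermitian_adjoint a"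
  have ae: "a ** e = mat 1" using a by (simp add: e_def W_def matrix_mul_assoc)
  have ea: "e ** a = mat 1" using ae matrix_left_right_inverse by blast
  have "hermitian_adjoint a ** hermitian_adjoint e = mat 1"
    using arg_cong[OF ea, of hermitian_adjoint] by simp
  then have W: "W = e ** hermitian_adjoint e"
    by (simp add: e_def matrix_mul_assoc[symmetric])
  have psd: "Re ((V ** W ** hermitian_adjoint V) $ 1 $ 1) \<ge> 0" for V :: "3 cmat"
    using gram_diag_nonneg[of "V ** e" 1] by (simp add: W matrix_mul_assoc)
  have "det W \<noteq> 0"
    using arg_cong[OF a, of det] unfolding W_def[symmetric] det_mul by auto
  moreover have "det W = of_real ((1 - t1 - t2 - t3)\<^sup>2)"
    unfolding W_def Z_def det_one_minus_skew t by simp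
  ultimately have s0: "1 - t1 - t2 - t3 \<noteq> 0" by auto
  show ?thesis
  proof (cases "t1 + t2 = 0")
    case True
    have "t1 \<ge> 0" "t2 \<ge> 0" by (simp_all add: t1_def t2_def)
    with True have "t1 = 0" "t2 = 0" by auto
    have "W $ 1 $ 1 = 1 - of_real t2 - of_real t3"
      by (simp add: W_def Z_def matrix_mult_nth sum_3 mat_nth t)
    with psd[of "mat 1"] have "1 - t2 - t3 \<ge> 0" by simp
    with s0 \<open>t1 = 0\<close> \<open>t2 = 0\<close> show ?thesis by (simp add: t1_def t2_def t3_def)
  next
    case False
    have "t1 \<ge> 0" "t2 \<ge> 0" by (simp_all add: t1_def t2_def)
    with False have pos: "t1 + t2 > 0" by auto
    \<comment> \<open>The row is orthogonal to the direction of eigenvalue 1, hence tests the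
      eigenvalue \<open>1 - |z|^2\<close>. It vanishes if \<open>z1 = z2 = 0\<close>, which explains
      the case split.\<close>
    define V :: "3 cmat" where "V = vector [vector [cnj z2, - cnj z1, 0], 0, 0]"
    have "(V ** W ** hermitian_adjoint V) $ 1 $ 1 =
        (z1 * cnj z1 + z2 * cnj z2) * (1 - z1 * cnj z1 - z2 * cnj z2 - z3 * cnj z3)"
      by (simp add: V_def W_def Z_def matrix_mult_nth sum_3 mat_nth) algebra
    then have "(V ** W ** hermitian_adjoint V) $ 1 $ 1 = of_real ((t1 + t2) * (1 - t1 - t2 - t3))"
      unfolding t by simp
    with psd[of V] have "(t1 + t2) * (1 - t1 - t2 - t3) \<ge> 0" by simp
    with pos s0 show ?thesis by (simp add: zero_le_mult_iff t1_def t2_def t3_def)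
  qed
qed

lemma SO_star_block_eqs:
  assumes "block a b (- conj_mat b) (conj_mat a) \<in> SO_star"
  shows "a ** hermitian_adjoint a - b ** hermitian_adjoint b = mat 1"
    and "a ** transpose b + b ** transpose a = 0"
    and "hermitian_adjoint a ** a - transpose b ** conj_mat b = mat 1"
  using SO_star_blockE[OF assms] by (metis block_eq_iff)+

text \<open>Since \<open>hermitian_adjoint a ** a\<close> is the identity plus a Gram matrix,
  \<open>a\<close> is injective. Then \<open>Z\<close> is the inverse of \<open>a\<close> times
  \<open>b\<close>, and the two row relations become the two claims.\<close>

lemma SO_star_skew_factor:
  assumes "block a b (- conj_mat b) (conj_mat a) \<in> SO_star"
  obtains Z where "b = a ** Z" "transpose Z = - Z"
    "a ** (mat 1 - Z ** hermitian_adjoint Z) ** hermitian_adjoint a = mat 1"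
proof -
  note eqs = SO_star_block_eqs[OF assms]
  have "x = 0" if "a *v x = 0" for x
  proof -
    \<comment> \<open>All columns equal \<open>x\<close>, so that \<open>gram_diag_nonneg\<close>
      applies to a vector.\<close>
    define X where "X = (\<chi> i (j::'a). x $ i)"
    have "a ** X = 0"
      using that by (simp add: vec_eq_iff X_def matrix_mult_nth matrix_vector_mult_def)
    then have "X = - (transpose b ** conj_mat b ** X)"
      using arg_cong[OF eqs(3), of "\<lambda>M. M ** X"]
      by (simp add: mm.diff_left matrix_mul_assoc[symmetric] del: matrix_mul_assoc)
    then have "hermitian_adjoint X ** X = - (hermitian_adjoint X ** (transpose b ** conj_mat b ** X))"
      by (metis mm.minus_right)
    also have "\<dots> = - ((hermitian_adjoint X ** transpose b) ** hermitian_adjoint (hermitian_adjoint X ** transpose b))"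
      by (simp add: matrix_mul_assoc)
    finally have "Re ((hermitian_adjoint X ** X) $ i $ i) \<le> 0" for i
      using gram_diag_nonneg[of "hermitian_adjoint X ** transpose b" i] by simp
    moreover have "(hermitian_adjoint X ** X) $ i $ i = of_real (\<Sum>k\<in>UNIV. (cmod (x $ k))\<^sup>2)" for i
      unfolding matrix_mult_nth of_real_sum
      by (intro sum.cong refl) (simp add: X_def complex_norm_square mult.commute del: of_real_power)
    ultimately have "(\<Sum>k\<in>UNIV. (cmod (x $ k))\<^sup>2) \<le> 0" by simp
    then have "(\<Sum>k\<in>UNIV. (cmod (x $ k))\<^sup>2) = 0" by (simp add: antisym sum_nonneg)
    then show "x = 0" by (simp add: sum_nonneg_eq_0_iff vec_eq_iff)
  qed
  then obtain e where ea: "e ** a = mat 1"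
    using matrix_left_invertible_ker[of a] by blast
  then have ae: "a ** e = mat 1" using matrix_left_right_inverse by blast
  define Z where "Z = e ** b"
  have b: "b = a ** Z" by (simp add: Z_def matrix_mul_assoc ae)
  have "a ** (transpose Z + Z) ** transpose a = 0"
    using eqs(2) by (simp add: b mm_simps)
  then have "e ** (a ** (transpose Z + Z) ** transpose a) ** transpose e = 0"
    by (simp add: mm_simps)
  moreover have "transpose a ** transpose e = mat 1"
    using arg_cong[OF ea, of transpose] by simp
  ultimately have "transpose Z + Z = 0"
    by (metis ea matrix_mul_assoc matrix_mul_lid matrix_mul_rid)
  moreover have "a ** (mat 1 - Z ** hermitian_adjoint Z) ** hermitian_adjoint a = mat 1"
    using eqs(1) by (simp add: b mm_simps)
  ultimately show thesis
    using that b by (simp add: eq_neg_iff_add_eq_0)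
qed

lemma projection_rank_one:
  fixes L \<xi> :: "real ^ 3"
  assumes M: "block a b (- conj_mat b) (conj_mat a) \<in> SO_star"
    and N: "a ** diag_mat L ** hermitian_adjoint a + b ** diag_mat L ** hermitian_adjoint b = diag_mat \<xi>"
    and L: "0 < L $ 2 + L $ 3" "0 < L $ 1 + L $ 3" "0 < L $ 1 + L $ 2"
  obtains h1 h2 h3 :: real where "0 \<le> h1" "0 \<le> h2" "0 \<le> h3"
    "\<And>x. (x - (\<xi> $ 1 - (h1 + h2 + h3))) * (x - (\<xi> $ 2 - (h1 + h2 + h3))) * (x - (\<xi> $ 3 - (h1 + h2 + h3))) =
      (x - L $ 1) * (x - L $ 2) * (x - L $ 3) +
      h1 * ((x - L $ 2) * (x - L $ 3)) + h2 * ((x - L $ 1) * (x - L $ 3)) + h3 * ((x - L $ 1) * (x - L $ 2))"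
proof -
  obtain Z where Z: "b = a ** Z" "transpose Z = - Z"
    "a ** (mat 1 - Z ** hermitian_adjoint Z) ** hermitian_adjoint a = mat 1"
    using SO_star_skew_factor[OF M] by blast
  obtain z1 z2 z3 where z: "Z = skew_mat z1 z2 z3"
    using skew_mat_exhaust[OF Z(2)] by blast
  define t1 t2 t3 where "t1 = (cmod z1)\<^sup>2" and "t2 = (cmod z2)\<^sup>2" and "t3 = (cmod z3)\<^sup>2"
  define s where "s = 1 - t1 - t2 - t3"
  define R where "R = t1 * (L $ 2 + L $ 3) + t2 * (L $ 1 + L $ 3) + t3 * (L $ 1 + L $ 2)"
  have s: "s > 0"
    using skew_norm_less_one[OF Z(3)[unfolded z]] by (simp add: s_def t1_def t2_def t3_def)
  define h1 h2 h3 where "h1 = t1 * (L $ 2 + L $ 3) / s" and "h2 = t2 * (L $ 1 + L $ 3) / s"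
    and "h3 = t3 * (L $ 1 + L $ 2) / s"
  have h: "0 \<le> h1" "0 \<le> h2" "0 \<le> h3"
    using L s by (simp_all add: h1_def h2_def h3_def t1_def t2_def t3_def)
  have sh: "t1 * (L $ 2 + L $ 3) = s * h1" "t2 * (L $ 1 + L $ 3) = s * h2" "t3 * (L $ 1 + L $ 2) = s * h3"
    using s by (simp_all add: h1_def h2_def h3_def)
  have R: "R = s * (h1 + h2 + h3)"
    unfolding R_def sh by (simp add: algebra_simps)
  show thesis
  proof (rule that[OF h])
    fix x
    \<comment> \<open>The shift by \<open>r = R / s\<close> turns every factor
      \<open>s * (y - l) - R\<close> into \<open>s * (x - l)\<close>.\<close>
    define y where "y = x + (h1 + h2 + h3)"
    have "of_real (s ^ 3 * ((y - \<xi> $ 1) * (y - \<xi> $ 2) * (y - \<xi> $ 3))) =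
        (of_real ((s * (y - L $ 1) - R) * (s * (y - L $ 2) - R) * (s * (y - L $ 3) - R) +
          t1 * (L $ 2 + L $ 3) * ((s * (y - L $ 2) - R) * (s * (y - L $ 3) - R)) +
          t2 * (L $ 1 + L $ 3) * ((s * (y - L $ 1) - R) * (s * (y - L $ 3) - R)) +
          t3 * (L $ 1 + L $ 2) * ((s * (y - L $ 1) - R) * (s * (y - L $ 2) - R))) :: complex)"
      using det_projection[OF Z(3)[unfolded z] Z(1)[unfolded z] N[symmetric], of y]
      unfolding det_diag t1_def[symmetric] t2_def[symmetric] t3_def[symmetric] s_def[symmetric] R_def[symmetric]
      by (simp only: of_real_mult)
    then have "s ^ 3 * ((y - \<xi> $ 1) * (y - \<xi> $ 2) * (y - \<xi> $ 3)) =
          (s * (y - L $ 1) - R) * (s * (y - L $ 2) - R) * (s * (y - L $ 3) - R) +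
          s * h1 * ((s * (y - L $ 2) - R) * (s * (y - L $ 3) - R)) +
          s * h2 * ((s * (y - L $ 1) - R) * (s * (y - L $ 3) - R)) +
          s * h3 * ((s * (y - L $ 1) - R) * (s * (y - L $ 2) - R))"
      unfolding of_real_eq_iff sh .
    moreover have sx: "s * (y - l) - R = s * (x - l)" for l
      by (simp add: R y_def algebra_simps)
    ultimately have "s ^ 3 * ((y - \<xi> $ 1) * (y - \<xi> $ 2) * (y - \<xi> $ 3)) =
        s ^ 3 * ((x - L $ 1) * (x - L $ 2) * (x - L $ 3) + h1 * ((x - L $ 2) * (x - L $ 3)) +
          h2 * ((x - L $ 1) * (x - L $ 3)) + h3 * ((x - L $ 1) * (x - L $ 2)))"
      unfolding sx by (simp only: power3_eq_cube distrib_left mult_ac)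
    then have "(y - \<xi> $ 1) * (y - \<xi> $ 2) * (y - \<xi> $ 3) =
        (x - L $ 1) * (x - L $ 2) * (x - L $ 3) + h1 * ((x - L $ 2) * (x - L $ 3)) +
          h2 * ((x - L $ 1) * (x - L $ 3)) + h3 * ((x - L $ 1) * (x - L $ 2))"
      using s by simp
    then show "(x - (\<xi> $ 1 - (h1 + h2 + h3))) * (x - (\<xi> $ 2 - (h1 + h2 + h3))) * (x - (\<xi> $ 3 - (h1 + h2 + h3))) =
      (x - L $ 1) * (x - L $ 2) * (x - L $ 3) +
      h1 * ((x - L $ 2) * (x - L $ 3)) + h2 * ((x - L $ 1) * (x - L $ 3)) + h3 * ((x - L $ 1) * (x - L $ 2))"
      by (simp add: y_def algebra_simps)
  qed
qed

subsection \<open>Realising interlacing eigenvalues\<close>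

text \<open>\<open>a\<close> is the inverse square root of \<open>1 - Z Z\<^sup>*\<close>, a combination of \<open>1\<close> and \<open>P = v v\<^sup>T\<close>.\<close>

lemma SO_star_boost:
  fixes v :: "real ^ 3"
  defines "Z \<equiv> skew_mat (of_real (v $ 1)) (of_real (v $ 2)) (of_real (v $ 3))"
  assumes v: "(v $ 1)\<^sup>2 + (v $ 2)\<^sup>2 + (v $ 3)\<^sup>2 < 1"
  obtains a where "block a (a ** Z) (- conj_mat (a ** Z)) (conj_mat a) \<in> SO_star"
    "a ** (mat 1 - Z ** hermitian_adjoint Z) ** hermitian_adjoint a = mat 1"
    "conj_mat a = a" "conj_mat Z = Z"
proof -
  define T where "T = (v $ 1)\<^sup>2 + (v $ 2)\<^sup>2 + (v $ 3)\<^sup>2"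
  define s where "s = 1 - T"
  define q where "q = sqrt s"
  define P :: "3 cmat" where "P = (\<chi> i j. of_real (v $ i * v $ j))"
  have s: "s > 0" using v by (simp add: s_def T_def)
  then have q: "q > 0" "q * q = s" by (simp_all add: q_def)
  have Z: "conj_mat Z = Z" "hermitian_adjoint Z = - Z" "transpose Z = - Z"
    by (simp_all add: vec_eq_iff forall_3 Z_def)
  have P: "conj_mat P = P" "hermitian_adjoint P = P" "transpose P = P"
    by (simp_all add: vec_eq_iff P_def mult.commute)
  have ZZ: "Z ** Z = P - T *\<^sub>R mat 1"
    by (simp add: vec_eq_iff forall_3 Z_def P_def T_def matrix_mult_nth sum_3 mat_nth power2_eq_square
        scaleR_conv_of_real[where 'a=complex])
  have PZ: "P ** Z = 0" "Z ** P = 0"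
    by (simp_all add: vec_eq_iff forall_3 Z_def P_def matrix_mult_nth sum_3)
  have PP: "P ** P = T *\<^sub>R P"
    by (simp add: vec_eq_iff forall_3 P_def T_def matrix_mult_nth sum_3 power2_eq_square algebra_simps
        scaleR_conv_of_real[where 'a=complex])
  \<comment> \<open>Here \<open>1 - Z Z\<^sup>* = s + P\<close> acts as \<open>s\<close> on the
    kernel of \<open>P\<close> and as 1 on \<open>v\<close>. So \<open>\<alpha>\<close> is the
    inverse root of \<open>s\<close>, and \<open>\<beta>\<close> solves
    \<open>\<alpha> + \<beta> T = 1\<close>; as \<open>T = (1 - q) (1 + q)\<close>, the division by
    \<open>T\<close> cancels and \<open>v = 0\<close> is covered.\<close>
  define \<alpha> \<beta> where "\<alpha> = 1 / q" and "\<beta> = - 1 / (q * (1 + q))"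
  have ss: "\<alpha> * \<alpha> * s = 1" using q s by (simp add: \<alpha>_def)
  have "T = (1 - q) * (1 + q)" using q s_def by (simp add: algebra_simps)
  then have ab1: "\<alpha> + \<beta> * T = 1"
    using q by (simp add: \<alpha>_def \<beta>_def divide_simps)
  have ab2: "\<beta> * (1 + \<alpha>) = - (\<alpha> * \<alpha>)"
    using q(1) by (simp add: \<alpha>_def \<beta>_def divide_simps)
  define a where "a = \<alpha> *\<^sub>R mat 1 + \<beta> *\<^sub>R P"
  have a: "conj_mat a = a" "hermitian_adjoint a = a" "transpose a = a"
    by (simp_all add: a_def P)
  have aP: "a ** P = P"
  proof -
    have "a ** P = (\<alpha> + \<beta> * T) *\<^sub>R P" by (simp add: a_def mm_simps PP scaleR_add_left)
    then show ?thesis by (simp add: ab1)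
  qed
  have aa: "a ** a = (\<alpha> * \<alpha>) *\<^sub>R (mat 1 - P)"
  proof -
    have "a ** a = \<alpha> *\<^sub>R a + \<beta> *\<^sub>R (a ** P)"
      by (subst (2) a_def) (simp add: mm_simps)
    also have "\<dots> = (\<alpha> * \<alpha>) *\<^sub>R mat 1 + (\<beta> * (1 + \<alpha>)) *\<^sub>R P"
      unfolding aP by (simp add: a_def scaleR_add_right scaleR_add_left algebra_simps)
    finally show ?thesis by (simp add: ab2 scaleR_diff_right)
  qed
  have aZ: "a ** Z = \<alpha> *\<^sub>R Z" "Z ** a = \<alpha> *\<^sub>R Z"
    by (simp_all add: a_def mm_simps PZ)
  define b where "b = \<alpha> *\<^sub>R Z"
  have b: "conj_mat b = b" "hermitian_adjoint b = - b" "transpose b = - b"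
    by (simp_all add: b_def Z)
  have bb: "b ** b = (\<alpha> * \<alpha>) *\<^sub>R (P - T *\<^sub>R mat 1)"
    by (simp add: b_def mm_simps ZZ)
  have aabb: "a ** a + b ** b = mat 1"
  proof -
    have "a ** a + b ** b = (\<alpha> * \<alpha> * s) *\<^sub>R mat 1"
      unfolding aa bb by (simp add: s_def scaleR_diff_right scaleR_diff_left algebra_simps)
    then show ?thesis by (simp add: ss)
  qed
  have comm: "a ** b = b ** a"
    by (simp add: b_def mm_simps aZ)
  show thesis
  proof
    have "- (a ** a) - b ** b = - mat 1"
      unfolding aabb[symmetric] by simp
    then have "block a b (- b) a \<in> SO_star"
      using det_block_rotation[OF aabb comm] aabb comm
      by (simp add: SO_star_def SU_nn_def a b mm_simps add.commute)
    then show "block a (a ** Z) (- conj_mat (a ** Z)) (conj_mat a) \<in> SO_star"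
      using b(1) a(1) unfolding aZ b_def[symmetric] by simp
    have "a ** (mat 1 - Z ** hermitian_adjoint Z) ** hermitian_adjoint a =
        a ** a + (a ** Z) ** (Z ** a)"
      by (simp add: a Z mm_simps)
    also have "\<dots> = mat 1" using aabb by (simp add: aZ b_def)
    finally show "a ** (mat 1 - Z ** hermitian_adjoint Z) ** hermitian_adjoint a = mat 1" .
  qed (fact a Z)+
qed

text \<open>Inverts the passage from the \<open>t_i = |z_i|^2\<close> to the weights:
  \<open>k_i = t_i / s\<close> is known from \<open>h_i\<close>, and a real \<open>Z\<close> with
  these moduli gives a real symmetric \<open>N\<close> with the prescribed characteristic
  polynomial.\<close>

lemma rank_one_projection:
  fixes L \<xi> :: "real ^ 3"
  assumes L: "0 < L $ 2 + L $ 3" "0 < L $ 1 + L $ 3" "0 < L $ 1 + L $ 2"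
    and \<xi>: "\<xi> $ 2 \<le> \<xi> $ 1" "\<xi> $ 3 \<le> \<xi> $ 2"
    and h: "0 \<le> h1" "0 \<le> h2" "0 \<le> h3"
    and eq: "\<And>x. (x - (\<xi> $ 1 - (h1 + h2 + h3))) * (x - (\<xi> $ 2 - (h1 + h2 + h3))) * (x - (\<xi> $ 3 - (h1 + h2 + h3))) =
      (x - L $ 1) * (x - L $ 2) * (x - L $ 3) +
      h1 * ((x - L $ 2) * (x - L $ 3)) + h2 * ((x - L $ 1) * (x - L $ 3)) + h3 * ((x - L $ 1) * (x - L $ 2))"
  shows "\<exists>a b. block a b (- conj_mat b) (conj_mat a) \<in> SO_star \<and>
    a ** diag_mat L ** hermitian_adjoint a + b ** diag_mat L ** hermitian_adjoint b = diag_mat \<xi>"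
proof -
  define k1 k2 k3 where "k1 = h1 / (L $ 2 + L $ 3)" and "k2 = h2 / (L $ 1 + L $ 3)" and "k3 = h3 / (L $ 1 + L $ 2)"
  have k: "0 \<le> k1" "0 \<le> k2" "0 \<le> k3" using h L by (simp_all add: k1_def k2_def k3_def)
  have hk: "k1 * (L $ 2 + L $ 3) = h1" "k2 * (L $ 1 + L $ 3) = h2" "k3 * (L $ 1 + L $ 2) = h3"
    using L by (simp_all add: k1_def k2_def k3_def)
  \<comment> \<open>Forced by \<open>t_i = s * k_i\<close> and
    \<open>s = 1 - t_1 - t_2 - t_3\<close>.\<close>
  define s where "s = 1 / (1 + k1 + k2 + k3)"
  have s: "s > 0" using k by (simp add: s_def)
  have ssum: "s * (1 + k1 + k2 + k3) = 1" using k by (simp add: s_def)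
  define v :: "real ^ 3" where "v = vector [sqrt (s * k1), sqrt (s * k2), sqrt (s * k3)]"
  have v: "(v $ 1)\<^sup>2 = s * k1" "(v $ 2)\<^sup>2 = s * k2" "(v $ 3)\<^sup>2 = s * k3"
    using s k by (simp_all add: v_def)
  have sv: "1 - s * k1 - s * k2 - s * k3 = s"
    using ssum by (simp add: algebra_simps)
  then have v1: "(v $ 1)\<^sup>2 + (v $ 2)\<^sup>2 + (v $ 3)\<^sup>2 < 1"
    unfolding v using s by linarith
  define Z where "Z = skew_mat (of_real (v $ 1)) (of_real (v $ 2)) (of_real (v $ 3))"
  obtain a where M: "block a (a ** Z) (- conj_mat (a ** Z)) (conj_mat a) \<in> SO_star"
    and a: "a ** (mat 1 - Z ** hermitian_adjoint Z) ** hermitian_adjoint a = mat 1"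
    "conj_mat a = a" "conj_mat Z = Z"
    using SO_star_boost[OF v1, folded Z_def] by blast
  define b where "b = a ** Z"
  define N where "N = a ** diag_mat L ** hermitian_adjoint a + b ** diag_mat L ** hermitian_adjoint b"
  have detN: "det (x *\<^sub>R mat 1 - N) = of_real ((x - \<xi> $ 1) * (x - \<xi> $ 2) * (x - \<xi> $ 3))" for x
  proof -
    define r where "r = h1 + h2 + h3"
    define y where "y = x - r"
    have R: "s * (x - l) - s * r = s * (y - l)" for l by (simp add: y_def algebra_simps)
    have sh: "s * k1 * (L $ 2 + L $ 3) = s * h1" "s * k2 * (L $ 1 + L $ 3) = s * h2" "s * k3 * (L $ 1 + L $ 2) = s * h3"
      using hk by (simp_all only: mult.assoc)
    have sr: "s * h1 + s * h2 + s * h3 = s * r" by (simp add: r_def algebra_simps)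
    have "of_real (s ^ 3) * det (x *\<^sub>R mat 1 - N) = of_real (
      (s * (x - L $ 1) - s * r) * (s * (x - L $ 2) - s * r) * (s * (x - L $ 3) - s * r) +
      s * h1 * ((s * (x - L $ 2) - s * r) * (s * (x - L $ 3) - s * r)) +
      s * h2 * ((s * (x - L $ 1) - s * r) * (s * (x - L $ 3) - s * r)) +
      s * h3 * ((s * (x - L $ 1) - s * r) * (s * (x - L $ 2) - s * r)))"
      using det_projection[OF a(1)[unfolded Z_def] b_def[unfolded Z_def] N_def, of x]
      by (simp only: norm_of_real power2_abs sv v sh sr)
    also have "\<dots> = of_real (s ^ 3 * ((y - L $ 1) * (y - L $ 2) * (y - L $ 3) +
      h1 * ((y - L $ 2) * (y - L $ 3)) + h2 * ((y - L $ 1) * (y - L $ 3)) + h3 * ((y - L $ 1) * (y - L $ 2))))"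
      unfolding R by (rule arg_cong[where f=of_real]) (simp add: power3_eq_cube algebra_simps)
    also have "\<dots> = of_real (s ^ 3) * of_real ((x - \<xi> $ 1) * (x - \<xi> $ 2) * (x - \<xi> $ 3))"
      unfolding eq[of y, symmetric] by (simp add: y_def r_def algebra_simps)
    finally show ?thesis using s by simp
  qed
  have Nreal: "conj_mat N = N" and Nherm: "hermitian_adjoint N = N"
  proof -
    have *: "hermitian_adjoint a = transpose a" "hermitian_adjoint Z = transpose Z"
      using arg_cong[OF a(2), of transpose] arg_cong[OF a(3), of transpose] by simp_all
    show "conj_mat N = N"
      by (simp add: N_def b_def a * matrix_mul_assoc)
    show "hermitian_adjoint N = N"
      by (simp add: N_def matrix_mul_assoc)
  qed
  \<comment> \<open>As \<open>N\<close> is real, the real spectral theorem applies to it.\<close>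
  define A :: "real ^ 3 ^ 3" where "A = (\<chi> i j. Re (N $ i $ j))"
  have NA: "N $ i $ j = of_real (A $ i $ j)" for i j
    using arg_cong[OF Nreal, of "\<lambda>M. M $ i $ j"] by (simp add: A_def complex_eq_iff)
  have "A $ i $ j = A $ j $ i" for i j
    using arg_cong[OF Nherm, of "\<lambda>M. M $ i $ j"] by (simp add: A_def complex_eq_iff)
  then have "transpose A = A" by (simp add: vec_eq_iff transpose_def)
  then obtain U :: "real ^ 3 ^ 3" and l :: "real ^ 3" where U: "U ** transpose U = mat 1"
    "\<And>i j. (U ** A ** transpose U) $ i $ j = (if i = j then l $ i else 0)"
    "l $ 2 \<le> l $ 1" "l $ 3 \<le> l $ 2"
    using symmetric_matrix_diagonalisation by blast
  define C :: "3 cmat" where "C = (\<chi> i j. of_real (U $ i $ j))"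
  have C: "conj_mat C = C" "hermitian_adjoint C = transpose C"
    by (simp_all add: vec_eq_iff C_def)
  have CC: "C ** transpose C = mat 1"
  proof -
    have "(C ** transpose C) $ i $ j = of_real ((U ** transpose U) $ i $ j)" for i j
      by (simp add: C_def matrix_mult_nth)
    then show ?thesis unfolding U(1) by (simp add: vec_eq_iff mat_nth)
  qed
  then have CC': "transpose C ** C = mat 1" using matrix_left_right_inverse by blast
  have CNC: "C ** N ** transpose C = diag_mat l"
  proof -
    have "(C ** N ** transpose C) $ i $ j = of_real ((U ** A ** transpose U) $ i $ j)" for i j
      by (simp add: C_def matrix_mult_nth NA)
    then show ?thesis unfolding U(2) by (simp add: vec_eq_iff diag_mat_nth)
  qed
  have "l $ 1 = \<xi> $ 1 \<and> l $ 2 = \<xi> $ 2 \<and> l $ 3 = \<xi> $ 3"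
  proof (rule sorted_roots_unique)
    fix x
    have "x *\<^sub>R mat 1 - diag_mat l = C ** (x *\<^sub>R mat 1 - N) ** transpose C"
      by (simp add: mm_simps CC CNC)
    then have "det (x *\<^sub>R mat 1 - diag_mat l) = det (x *\<^sub>R mat 1 - N) * (det C * det (transpose C))"
      by (simp only: det_mul mult_ac)
    also have "det C * det (transpose C) = 1"
      by (simp only: det_mul[symmetric] CC det_I)
    finally show "(x - l $ 1) * (x - l $ 2) * (x - l $ 3) = (x - \<xi> $ 1) * (x - \<xi> $ 2) * (x - \<xi> $ 3)"
      unfolding det_diag detN by (simp only: mult_1_right of_real_eq_iff)
  qed (use U \<xi> in auto)
  then have "l = \<xi>" by (simp add: vec_eq_iff forall_3)
  \<comment> \<open>Multiplying on the left by this element of \<open>K\<close> replaces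
    \<open>N\<close> by its conjugate under \<open>C\<close>, which is diagonal.\<close>
  have "block C 0 0 (conj_mat C) \<in> K_group"
    using CC' by (auto simp: K_group_def unitary_group_def C(2))
  then have "block C 0 0 (conj_mat C) \<in> SO_star" using K_group_subset_SO_star by blast
  from SO_star_mult[OF this M]
  have "block (C ** a) (C ** b) (- conj_mat (C ** b)) (conj_mat (C ** a)) \<in> SO_star"
    by (simp add: b_def mm_simps)
  moreover have "(C ** a) ** diag_mat L ** hermitian_adjoint (C ** a) + (C ** b) ** diag_mat L ** hermitian_adjoint (C ** b) =
      C ** N ** transpose C"
    by (simp add: N_def mm_simps C(2))
  ultimately show ?thesis using CNC \<open>l = \<xi>\<close> by metis
qed

theorem mainTheorem10:
  fixes \<Lambda> :: "real ^ 3"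
  assumes "\<Lambda> \<in> rational_weights_plus \<inter> C_hol"
  shows "kirwan_polyhedron (coadjoint_orbit \<Lambda>) =
    {\<xi> :: real ^ 3.
       - \<xi>$1 + \<xi>$2 + \<xi>$3 \<ge> - \<Lambda>$1 + \<Lambda>$2 + \<Lambda>$3 \<and>
       \<xi>$1 - \<xi>$2 + \<xi>$3 \<ge> \<Lambda>$1 - \<Lambda>$2 + \<Lambda>$3 \<and>
       \<xi>$1 + \<xi>$2 - \<xi>$3 \<ge> \<Lambda>$1 + \<Lambda>$2 - \<Lambda>$3 \<and>
       \<xi>$1 - \<xi>$2 - \<xi>$3 \<ge> - \<Lambda>$1 + \<Lambda>$2 - \<Lambda>$3 \<and>
       - \<xi>$1 + \<xi>$2 - \<xi>$3 \<ge> - \<Lambda>$1 - \<Lambda>$2 + \<Lambda>$3 \<and>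
       \<xi>$1 \<ge> \<xi>$2 \<and> \<xi>$2 \<ge> \<xi>$3}"
proof -
  have ord: "\<Lambda> $ 2 \<le> \<Lambda> $ 1" "\<Lambda> $ 3 \<le> \<Lambda> $ 2"
    using assms by (auto simp: rational_weights_plus_def t_dual_plus_def)
  have pos: "0 < \<Lambda> $ 2 + \<Lambda> $ 3" "0 < \<Lambda> $ 1 + \<Lambda> $ 3" "0 < \<Lambda> $ 1 + \<Lambda> $ 2"
    using assms C_hol_pos[of \<Lambda> 2 3] C_hol_pos[of \<Lambda> 1 3] C_hol_pos[of \<Lambda> 1 2] by auto
  show ?thesis
    unfolding kirwan_polyhedron_eq
  proof (intro equalityI subsetI CollectI)
    fix \<xi> assume "\<xi> \<in> {\<xi> \<in> t_dual_plus. \<exists>a b. block a b (- conj_mat b) (conj_mat a) \<in> SO_star \<and>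
      a ** diag_mat \<Lambda> ** hermitian_adjoint a + b ** diag_mat \<Lambda> ** hermitian_adjoint b = diag_mat \<xi>}"
    then obtain a b where M: "block a b (- conj_mat b) (conj_mat a) \<in> SO_star"
      and N: "a ** diag_mat \<Lambda> ** hermitian_adjoint a + b ** diag_mat \<Lambda> ** hermitian_adjoint b = diag_mat \<xi>"
      and \<xi>: "\<xi> $ 2 \<le> \<xi> $ 1" "\<xi> $ 3 \<le> \<xi> $ 2"
      by (auto simp: t_dual_plus_def)
    obtain h1 h2 h3 where h: "0 \<le> h1" "0 \<le> h2" "0 \<le> h3" and
      eq: "\<And>x. (x - (\<xi> $ 1 - (h1 + h2 + h3))) * (x - (\<xi> $ 2 - (h1 + h2 + h3))) * (x - (\<xi> $ 3 - (h1 + h2 + h3))) =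
      (x - \<Lambda> $ 1) * (x - \<Lambda> $ 2) * (x - \<Lambda> $ 3) +
      h1 * ((x - \<Lambda> $ 2) * (x - \<Lambda> $ 3)) + h2 * ((x - \<Lambda> $ 1) * (x - \<Lambda> $ 3)) + h3 * ((x - \<Lambda> $ 1) * (x - \<Lambda> $ 2))"
      using projection_rank_one[OF M N pos] by blast
    \<comment> \<open>With \<open>r = h1 + h2 + h3\<close> the trace identity determines
      \<open>2 r\<close>. The three upper bounds on the \<open>\<xi> $ i - r\<close> then become the
      first three inequalities and the two lower bounds the next two.\<close>
    show "- \<xi>$1 + \<xi>$2 + \<xi>$3 \<ge> - \<Lambda>$1 + \<Lambda>$2 + \<Lambda>$3 \<and>
       \<xi>$1 - \<xi>$2 + \<xi>$3 \<ge> \<Lambda>$1 - \<Lambda>$2 + \<Lambda>$3 \<and>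
       \<xi>$1 + \<xi>$2 - \<xi>$3 \<ge> \<Lambda>$1 + \<Lambda>$2 - \<Lambda>$3 \<and>
       \<xi>$1 - \<xi>$2 - \<xi>$3 \<ge> - \<Lambda>$1 + \<Lambda>$2 - \<Lambda>$3 \<and>
       - \<xi>$1 + \<xi>$2 - \<xi>$3 \<ge> - \<Lambda>$1 - \<Lambda>$2 + \<Lambda>$3 \<and>
       \<xi>$1 \<ge> \<xi>$2 \<and> \<xi>$2 \<ge> \<xi>$3"
      using interlacing_of_rank_one[OF ord _ _ h eq] rank_one_trace[OF eq] \<xi> by auto
  next
    fix \<xi> :: "real ^ 3"
    assume "\<xi> \<in> {\<xi>. - \<xi>$1 + \<xi>$2 + \<xi>$3 \<ge> - \<Lambda>$1 + \<Lambda>$2 + \<Lambda>$3 \<and>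
       \<xi>$1 - \<xi>$2 + \<xi>$3 \<ge> \<Lambda>$1 - \<Lambda>$2 + \<Lambda>$3 \<and>
       \<xi>$1 + \<xi>$2 - \<xi>$3 \<ge> \<Lambda>$1 + \<Lambda>$2 - \<Lambda>$3 \<and>
       \<xi>$1 - \<xi>$2 - \<xi>$3 \<ge> - \<Lambda>$1 + \<Lambda>$2 - \<Lambda>$3 \<and>
       - \<xi>$1 + \<xi>$2 - \<xi>$3 \<ge> - \<Lambda>$1 - \<Lambda>$2 + \<Lambda>$3 \<and>
       \<xi>$1 \<ge> \<xi>$2 \<and> \<xi>$2 \<ge> \<xi>$3}"
    then have ineqs: "- \<xi>$1 + \<xi>$2 + \<xi>$3 \<ge> - \<Lambda>$1 + \<Lambda>$2 + \<Lambda>$3"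
       "\<xi>$1 - \<xi>$2 + \<xi>$3 \<ge> \<Lambda>$1 - \<Lambda>$2 + \<Lambda>$3"
       "\<xi>$1 + \<xi>$2 - \<xi>$3 \<ge> \<Lambda>$1 + \<Lambda>$2 - \<Lambda>$3"
       "\<xi>$1 - \<xi>$2 - \<xi>$3 \<ge> - \<Lambda>$1 + \<Lambda>$2 - \<Lambda>$3"
       "- \<xi>$1 + \<xi>$2 - \<xi>$3 \<ge> - \<Lambda>$1 - \<Lambda>$2 + \<Lambda>$3"
       "\<xi>$1 \<ge> \<xi>$2" "\<xi>$2 \<ge> \<xi>$3" by auto
    define r where "r = ((\<xi>$1 + \<xi>$2 + \<xi>$3) - (\<Lambda>$1 + \<Lambda>$2 + \<Lambda>$3)) / 2"
    have "\<xi> $ 1 - r \<le> \<Lambda> $ 1" "\<Lambda> $ 2 \<le> \<xi> $ 1 - r" "\<xi> $ 2 - r \<le> \<Lambda> $ 2" "\<Lambda> $ 3 \<le> \<xi> $ 2 - r"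
      "\<xi> $ 3 - r \<le> \<Lambda> $ 3"
      using ineqs unfolding r_def by (simp_all add: field_simps)
    from rank_one_of_interlacing[OF this] obtain h1 h2 h3 where h: "0 \<le> h1" "0 \<le> h2" "0 \<le> h3" and
      eq: "\<And>x. (x - (\<xi> $ 1 - r)) * (x - (\<xi> $ 2 - r)) * (x - (\<xi> $ 3 - r)) =
      (x - \<Lambda> $ 1) * (x - \<Lambda> $ 2) * (x - \<Lambda> $ 3) +
      h1 * ((x - \<Lambda> $ 2) * (x - \<Lambda> $ 3)) + h2 * ((x - \<Lambda> $ 1) * (x - \<Lambda> $ 3)) + h3 * ((x - \<Lambda> $ 1) * (x - \<Lambda> $ 2))"
      by blast
    \<comment> \<open>The weights were obtained without control of their sum; comparing traces shows
      that it is \<open>r\<close>, as \<open>rank_one_projection\<close> requires.\<close>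
    have "2 * r = (\<xi>$1 + \<xi>$2 + \<xi>$3) - (\<Lambda>$1 + \<Lambda>$2 + \<Lambda>$3)"
      by (simp add: r_def)
    with rank_one_trace[OF eq] have r: "r = h1 + h2 + h3" by linarith
    show "\<xi> \<in> t_dual_plus \<and> (\<exists>a b. block a b (- conj_mat b) (conj_mat a) \<in> SO_star \<and>
      a ** diag_mat \<Lambda> ** hermitian_adjoint a + b ** diag_mat \<Lambda> ** hermitian_adjoint b = diag_mat \<xi>)"
      using rank_one_projection[OF pos ineqs(6,7) h eq[unfolded r]] ineqs(6,7) by (simp add: t_dual_plus_def)
  qed
qed

end
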